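(* Let $G$ be a distributed system over a finite directed graph $\mathcal{G}(V,E)$ given by a balanced realization with balanced generalized gramians $\Sigma^{(k)}(t)=\mathrm{diag}(\Gamma^{(k)}(t),\Omega^{(k)}(t))$ and $\Sigma^{(ij)}(t)=\mathrm{diag}(\Gamma^{(ij)}(t),\Omega^{(ij)}(t))$, and let $G_r$ be the reduced order system obtained by balanced truncation of the states corresponding to the blocks $\Omega^{(k)}(t)$, $\Omega^{(ij)}(t)$. For $k\in V$ and $(i,j)\in E$ let $$\mathcal{F}_k=\{t\in\mathbb{N}_0\mid n^{(k)}(t)\neq r^{(k)}(t)\},\qquad \mathcal{F}_{(ij)}=\{t\in\mathbb{N}_0\mid n^{(ij)}(t)\ne r^{(ij)}(t)\}$$ be the sets of times at which truncation occurs. Suppose that for all $k\in V$ and $(i,j)\in E$ we have $\Omega^{(k)}(t)=w^{(k)}(t)I$ for $t\in\mathcal{F}_k$ and $\Omega^{(ij)}(t)=w^{(ij)}(t)I$ for $t\in\mathcal{F}_{(ij)}$, where each of the scalar sequences $(w^{(k)}(t))_{t\in\mathcal{F}_k}$ and $(w^{(ij)}(t))_{t\in\mathcal{F}_{(ij)}}$ is monotonic in time (nondecreasing or nonincreasing). Then $$\|G-G_r\|<2\left(\sum_{k\in V}\sup_{t\in\mathcal{F}_k}w^{(k)}(t)+\sum_{(i,j)\in E}\sup_{t\in\mathcal{F}_{(ij)}}w^{(ij)}(t)\right),$$ where a supremum over an empty set is taken to be $0$.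
   Context: **Systems.** $\mathcal{G}(V,E)$ is a finite directed graph with $V=\{1,\dots,N\}$. For $k\in V$, $E_{\mathrm{in}}^{(k)}=\{i\in V\mid (i,k)\in E\}$ and $E_{\mathrm{out}}^{(k)}=\{j\in V\mid (k,j)\in E\}$, both ordered increasingly. A distributed system $G$ has, for each $k\in V$ and $t\in\mathbb{N}_0$, a temporal state $x^{(k)}(t)\in\mathbb{R}^{n^{(k)}(t)}$, input $u^{(k)}(t)\in\mathbb{R}^{n_u^{(k)}(t)}$, output $y^{(k)}(t)\in\mathbb{R}^{n_y^{(k)}(t)}$, and for each edge $(i,j)\in E$ a spatial state $x^{(ij)}(t)\in\mathbb{R}^{n^{(ij)}(t)}$ (all dimensions may vary with time and may be zero). Let $x_{\mathrm{in}}^{(k)}(t)$ be the vertical concatenation of $x^{(ik)}(t)$, $i\in E_{\mathrm{in}}^{(k)}$, and $x_{\mathrm{out}}^{(k)}(t)$ the vertical concatenation of $x^{(kj)}(t)$, $j\in E_{\mathrm{out}}^{(k)}$. The dynamics are, with $x^{(k)}(0)=0$, $x_{\mathrm{in}}^{(k)}(0)=0$, for all $(t,k)\in\mathbb{N}_0\times V$, $$\begin{bmatrix} x^{(k)}(t+1) \\ x_{\mathrm{out}}^{(k)}(t+1)\end{bmatrix}=A^{(k)}(t)\begin{bmatrix} x^{(k)}(t) \\ x_{\mathrm{in}}^{(k)}(t)\end{bmatrix}+B^{(k)}(t)u^{(k)}(t),\qquad y^{(k)}(t)=C^{(k)}(t)\begin{bmatrix} x^{(k)}(t) \\ x_{\mathrm{in}}^{(k)}(t)\end{bmatrix}+D^{(k)}(t)u^{(k)}(t),$$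 where the matrices are uniformly bounded in $t$. The quadruple $(A^{(k)}(t),B^{(k)}(t),C^{(k)}(t),D^{(k)}(t))$ is the realization of $G$. For a family $Z^{(ij)}(t)$ of matrices indexed by edges, $Z_{\mathrm{in}}^{(k)}(t)=\mathrm{diag}(Z^{(ik)}(t))_{i\in E_{\mathrm{in}}^{(k)}}$ and $Z_{\mathrm{out}}^{(k)}(t)=\mathrm{diag}(Z^{(kj)}(t))_{j\in E_{\mathrm{out}}^{(k)}}$ (block-diagonal). **Balanced realization.** The realization is balanced if there exist $\beta>0$ and uniformly bounded diagonal positive definite matrices $\Sigma^{(k)}(t)\succ\beta I$ (size $n^{(k)}(t)$), $\Sigma^{(ij)}(t)\succ\beta I$ (size $n^{(ij)}(t)$), called balanced generalized gramians, such that for all $(t,k)\in\mathbb{N}_0\times V$ $$A^{(k)}(t)\,\mathrm{diag}(\Sigma^{(k)}(t),\Sigma_{\mathrm{in}}^{(k)}(t))A^{(k)}(t)^T-\mathrm{diag}(\Sigma^{(k)}(t+1),\Sigma_{\mathrm{out}}^{(k)}(t+1))+B^{(k)}(t)B^{(k)}(t)^T\prec-\beta I,$$ $$A^{(k)}(t)^T\mathrm{diag}(\Sigma^{(k)}(t+1),\Sigma_{\mathrm{out}}^{(k)}(t+1))A^{(k)}(t)-\mathrm{diag}(\Sigma^{(k)}(t),\Sigma_{\mathrm{in}}^{(k)}(t))+C^{(k)}(t)^TC^{(k)}(t)\prec-\beta I.$$ The diagonal entries of each gramian are assumed, without loss of generality, ordered in a decreasing fashion. **Balanced truncation.** Given integers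 $0\le r^{(k)}(t)\le n^{(k)}(t)$ and $0\le r^{(ij)}(t)\le n^{(ij)}(t)$, write $\Sigma^{(k)}(t)=\mathrm{diag}(\Gamma^{(k)}(t),\Omega^{(k)}(t))$ and $\Sigma^{(ij)}(t)=\mathrm{diag}(\Gamma^{(ij)}(t),\Omega^{(ij)}(t))$ with $\Gamma^{(k)}(t)$ of size $r^{(k)}(t)$ and $\Gamma^{(ij)}(t)$ of size $r^{(ij)}(t)$ (blocks may have size zero). The reduced order system $G_r$, over the same graph, has temporal states of dimension $r^{(k)}(t)$, spatial states of dimension $r^{(ij)}(t)$, and realization $(A_r^{(k)}(t),B_r^{(k)}(t),C_r^{(k)}(t),D^{(k)}(t))$ obtained from that of $G$ by keeping, at each time, only the rows and columns corresponding to the first $r^{(k)}(t)$ components of each $x^{(k)}(t)$ and the first $r^{(ij)}(t)$ components of each $x^{(ij)}(t)$ (rows of $A^{(k)}(t)$, $B^{(k)}(t)$ according to the states at time $t+1$; columns of $A^{(k)}(t)$, $C^{(k)}(t)$ according to the states at time $t$). **Norm.** $\ell_2$ is the space of $w=(w^{(k)}(t))$ with $\|w\|_2=(\sum_{(t,k)}w^{(k)}(t)^Tw^{(k)}(t))^{1/2}<\infty$. For a system mapping $u\in\ell_2$ to $y\in\ell_2$ (from zero initial conditions), $\|G\|=\sup_{0\ne u\in\ell_2}\|y\|_2/\|u\|_2$. $G-G_r$ denotes the error system mapping $u$ to the difference of the outputs of $G$ and $G_r$.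
   Formalization: It is additionally assumed that at least one of the sets of truncation times F_k, F_(ij) is nonempty; if nothing is truncated then G_r = G, both sides are 0 and the strict inequality fails. *)

theory Defs
  imports
    "Jordan_Normal_Form.Matrix"
    "Jordan_Normal_Form.DL_Submatrix"
    "HOL-Library.Extended_Nonnegative_Real"
begin

section \<open>Vectors and matrices\<close>

definition vec_norm2 :: "real vec \<Rightarrow> real" where
  "vec_norm2 v = sqrt (v \<bullet> v)"

definition concat_vec :: "real vec list \<Rightarrow> real vec" where
  "concat_vec vs = foldr (@\<^sub>v) vs (0\<^sub>v 0)"

text \<open>Uniform boundedness in the operator norm. The dimensions of \<open>M t\<close> may be unbounded in \<open>t\<close>,
  so a uniform bound on the entries would be a weaker property.\<close>

definition uniformly_bounded :: "(nat \<Rightarrow> real mat) \<Rightarrow> bool" where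
  "uniformly_bounded M \<longleftrightarrow>
     (\<exists>c. \<forall>t. \<forall>v \<in> carrier_vec (dim_col (M t)). vec_norm2 (M t *\<^sub>v v) \<le> c * vec_norm2 v)"

definition pos_def :: "real mat \<Rightarrow> bool" where
  "pos_def M \<longleftrightarrow> square_mat M \<and> M\<^sup>T = M \<and>
     (\<forall>v \<in> carrier_vec (dim_row M). v \<noteq> 0\<^sub>v (dim_row M) \<longrightarrow> 0 < v \<bullet> (M *\<^sub>v v))"

text \<open>Strict Loewner order. On \<open>0 \<times> 0\<close> matrices it holds vacuously.\<close>

definition loewner_less :: "real mat \<Rightarrow> real mat \<Rightarrow> bool" (infix \<open>\<prec>\<^sub>L\<close> 50) where
  "X \<prec>\<^sub>L Y \<longleftrightarrow> dim_row X = dim_row Y \<and> dim_col X = dim_col Y \<and> pos_def (Y - X)"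

definition decreasing_diag :: "real mat \<Rightarrow> bool" where
  "decreasing_diag M \<longleftrightarrow> (\<forall>i j. i \<le> j \<longrightarrow> j < dim_row M \<longrightarrow> M $$ (j,j) \<le> M $$ (i,i))"

section \<open>Distributed systems over a directed graph\<close>

text \<open>The vertices are \<open>1, \<dots>, N\<close> and the edge set is a set of pairs. Node data are indexed by node and
  time, edge data by edge and time.\<close>

type_synonym signal = "nat \<Rightarrow> nat \<Rightarrow> real vec"
type_synonym edge_signal = "nat \<times> nat \<Rightarrow> nat \<Rightarrow> real vec"

abbreviation nodes :: "nat \<Rightarrow> nat set" where
  "nodes N \<equiv> {1..N}"

definition in_nbrs :: "(nat \<times> nat) set \<Rightarrow> nat \<Rightarrow> nat list" where
  "in_nbrs E k = sorted_list_of_set {i. (i, k) \<in> E}"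

definition out_nbrs :: "(nat \<times> nat) set \<Rightarrow> nat \<Rightarrow> nat list" where
  "out_nbrs E k = sorted_list_of_set {j. (k, j) \<in> E}"

text \<open>The item of node \<open>k\<close> followed by the items of its incoming (outgoing) edges. Used for
  dimensions, for states (to be concatenated) and for gramians (to be put on a block diagonal).\<close>

definition at_in :: "(nat \<times> nat) set \<Rightarrow> (nat \<Rightarrow> nat \<Rightarrow> 'a) \<Rightarrow> (nat \<times> nat \<Rightarrow> nat \<Rightarrow> 'a)
    \<Rightarrow> nat \<Rightarrow> nat \<Rightarrow> 'a list" where
  "at_in E f g k t = f k t # map (\<lambda>i. g (i, k) t) (in_nbrs E k)"

definition at_out :: "(nat \<times> nat) set \<Rightarrow> (nat \<Rightarrow> nat \<Rightarrow> 'a) \<Rightarrow> (nat \<times> nat \<Rightarrow> nat \<Rightarrow> 'a)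
    \<Rightarrow> nat \<Rightarrow> nat \<Rightarrow> 'a list" where
  "at_out E f g k t = f k t # map (\<lambda>j. g (k, j) t) (out_nbrs E k)"

record dist_sys =
  tdim :: "nat \<Rightarrow> nat \<Rightarrow> nat"  \<comment> \<open>temporal states\<close>
  sdim :: "nat \<times> nat \<Rightarrow> nat \<Rightarrow> nat"  \<comment> \<open>spatial states\<close>
  udim :: "nat \<Rightarrow> nat \<Rightarrow> nat"
  ydim :: "nat \<Rightarrow> nat \<Rightarrow> nat"
  Amat :: "nat \<Rightarrow> nat \<Rightarrow> real mat"
  Bmat :: "nat \<Rightarrow> nat \<Rightarrow> real mat"
  Cmat :: "nat \<Rightarrow> nat \<Rightarrow> real mat"
  Dmat :: "nat \<Rightarrow> nat \<Rightarrow> real mat"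

abbreviation in_dims :: "(nat \<times> nat) set \<Rightarrow> dist_sys \<Rightarrow> nat \<Rightarrow> nat \<Rightarrow> nat list" where
  "in_dims E S \<equiv> at_in E (tdim S) (sdim S)"

abbreviation out_dims :: "(nat \<times> nat) set \<Rightarrow> dist_sys \<Rightarrow> nat \<Rightarrow> nat \<Rightarrow> nat list" where
  "out_dims E S \<equiv> at_out E (tdim S) (sdim S)"

definition distributed_system :: "nat \<Rightarrow> (nat \<times> nat) set \<Rightarrow> dist_sys \<Rightarrow> bool" where
  "distributed_system N E S \<longleftrightarrow>
     E \<subseteq> nodes N \<times> nodes N \<and>
     (\<forall>k \<in> nodes N.
        (\<forall>t. Amat S k t \<in> carrier_mat (sum_list (out_dims E S k (t+1))) (sum_list (in_dims E S k t)) \<and>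
             Bmat S k t \<in> carrier_mat (sum_list (out_dims E S k (t+1))) (udim S k t) \<and>
             Cmat S k t \<in> carrier_mat (ydim S k t) (sum_list (in_dims E S k t)) \<and>
             Dmat S k t \<in> carrier_mat (ydim S k t) (udim S k t)) \<and>
        uniformly_bounded (Amat S k) \<and> uniformly_bounded (Bmat S k) \<and>
        uniformly_bounded (Cmat S k) \<and> uniformly_bounded (Dmat S k))"

definition is_signal :: "nat \<Rightarrow> (nat \<Rightarrow> nat \<Rightarrow> nat) \<Rightarrow> signal \<Rightarrow> bool" where
  "is_signal N d w \<longleftrightarrow> (\<forall>k \<in> nodes N. \<forall>t. w k t \<in> carrier_vec (d k t))"

definition is_trajectory :: "nat \<Rightarrow> (nat \<times> nat) set \<Rightarrow> dist_sys \<Rightarrow>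
    signal \<Rightarrow> signal \<Rightarrow> edge_signal \<Rightarrow> signal \<Rightarrow> bool" where
  "is_trajectory N E S u x xs y \<longleftrightarrow>
     is_signal N (udim S) u \<and> is_signal N (tdim S) x \<and> is_signal N (ydim S) y \<and>
     (\<forall>e \<in> E. \<forall>t. xs e t \<in> carrier_vec (sdim S e t)) \<and>
     (\<forall>k \<in> nodes N. x k 0 = 0\<^sub>v (tdim S k 0)) \<and>
     (\<forall>e \<in> E. xs e 0 = 0\<^sub>v (sdim S e 0)) \<and>
     (\<forall>k \<in> nodes N. \<forall>t.
        concat_vec (at_out E x xs k (t+1)) =
          Amat S k t *\<^sub>v concat_vec (at_in E x xs k t) + Bmat S k t *\<^sub>v u k t \<and>
        y k t = Cmat S k t *\<^sub>v concat_vec (at_in E x xs k t) + Dmat S k t *\<^sub>v u k t)"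

text \<open>A system as an input-output map, represented by its graph. By the lemmas
  \<open>io_map_total\<close> and \<open>io_map_unique\<close> below, every input has exactly one output on the nodes.\<close>

definition io_map :: "nat \<Rightarrow> (nat \<times> nat) set \<Rightarrow> dist_sys \<Rightarrow> (signal \<times> signal) set" where
  "io_map N E S = {(u, y). \<exists>x xs. is_trajectory N E S u x xs y}"

definition error_map :: "(signal \<times> signal) set \<Rightarrow> (signal \<times> signal) set \<Rightarrow> (signal \<times> signal) set" where
  "error_map G H = {(u, \<lambda>k t. y k t - z k t) | u y z. (u, y) \<in> G \<and> (u, z) \<in> H}"

section \<open>The induced norm\<close>

definition l2_norm :: "nat \<Rightarrow> signal \<Rightarrow> ennreal" where
  "l2_norm N w =
     (if summable (\<lambda>t. \<Sum>k \<in> nodes N. w k t \<bullet> w k t)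
      then ennreal (sqrt (\<Sum>t. \<Sum>k \<in> nodes N. w k t \<bullet> w k t)) else \<infinity>)"

definition nonzero_signal :: "nat \<Rightarrow> signal \<Rightarrow> bool" where
  "nonzero_signal N w \<longleftrightarrow> (\<exists>k \<in> nodes N. \<exists>t. w k t \<noteq> 0\<^sub>v (dim_vec (w k t)))"

text \<open>The value is \<open>\<infinity>\<close> if some square-summable input has an output that is not square-summable.\<close>

definition induced_norm :: "nat \<Rightarrow> (signal \<times> signal) set \<Rightarrow> ennreal" where
  "induced_norm N G =
     (SUP (u, y) \<in> {(u, y) \<in> G. l2_norm N u < \<infinity> \<and> nonzero_signal N u}. l2_norm N y / l2_norm N u)"

section \<open>Balanced realizations and balanced truncation\<close>

definition balanced_gramians :: "nat \<Rightarrow> (nat \<times> nat) set \<Rightarrow> dist_sys \<Rightarrow>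
    (nat \<Rightarrow> nat \<Rightarrow> real mat) \<Rightarrow> (nat \<times> nat \<Rightarrow> nat \<Rightarrow> real mat) \<Rightarrow> bool" where
  "balanced_gramians N E S \<Sigma> \<Sigma>s \<longleftrightarrow> (\<exists>\<beta>>0.
     (\<forall>k \<in> nodes N. uniformly_bounded (\<Sigma> k) \<and>
        (\<forall>t. \<Sigma> k t \<in> carrier_mat (tdim S k t) (tdim S k t) \<and> diagonal_mat (\<Sigma> k t) \<and>
             \<beta> \<cdot>\<^sub>m 1\<^sub>m (tdim S k t) \<prec>\<^sub>L \<Sigma> k t \<and> decreasing_diag (\<Sigma> k t))) \<and>
     (\<forall>e \<in> E. uniformly_bounded (\<Sigma>s e) \<and>
        (\<forall>t. \<Sigma>s e t \<in> carrier_mat (sdim S e t) (sdim S e t) \<and> diagonal_mat (\<Sigma>s e t) \<and>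
             \<beta> \<cdot>\<^sub>m 1\<^sub>m (sdim S e t) \<prec>\<^sub>L \<Sigma>s e t \<and> decreasing_diag (\<Sigma>s e t))) \<and>
     (\<forall>k \<in> nodes N. \<forall>t.
        let A = Amat S k t; B = Bmat S k t; C = Cmat S k t;
            X = diag_block_mat (at_in E \<Sigma> \<Sigma>s k t);
            Y = diag_block_mat (at_out E \<Sigma> \<Sigma>s k (t+1))
        in A * X * A\<^sup>T - Y + B * B\<^sup>T \<prec>\<^sub>L (- \<beta>) \<cdot>\<^sub>m 1\<^sub>m (dim_row A) \<and>
           A\<^sup>T * Y * A - X + C\<^sup>T * C \<prec>\<^sub>L (- \<beta>) \<cdot>\<^sub>m 1\<^sub>m (dim_col A)))"

text \<open>\<open>kept ds rs\<close> is the set of positions, in a concatenation of blocks of sizes \<open>ds\<close>, that belong to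
  the first \<open>rs ! b\<close> components of some block \<open>b\<close>.\<close>

fun kept :: "nat list \<Rightarrow> nat list \<Rightarrow> nat set" where
  "kept (d # ds) (r # rs) = {..<r} \<union> (\<lambda>i. d + i) ` kept ds rs"
| "kept _ _ = {}"

definition truncation :: "(nat \<times> nat) set \<Rightarrow> dist_sys \<Rightarrow>
    (nat \<Rightarrow> nat \<Rightarrow> nat) \<Rightarrow> (nat \<times> nat \<Rightarrow> nat \<Rightarrow> nat) \<Rightarrow> dist_sys" where
  "truncation E S r rs =
     (let rows = (\<lambda>k t. kept (out_dims E S k (t+1)) (at_out E r rs k (t+1)));
          cols = (\<lambda>k t. kept (in_dims E S k t) (at_in E r rs k t))
      in S\<lparr>tdim := r, sdim := rs,
           Amat := \<lambda>k t. submatrix (Amat S k t) (rows k t) (cols k t),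
           Bmat := \<lambda>k t. submatrix (Bmat S k t) (rows k t) UNIV,
           Cmat := \<lambda>k t. submatrix (Cmat S k t) UNIV (cols k t)\<rparr>)"

definition trunc_times :: "(nat \<Rightarrow> nat) \<Rightarrow> (nat \<Rightarrow> nat) \<Rightarrow> nat set" where
  "trunc_times d r = {t. d t \<noteq> r t}"

section \<open>Existence and uniqueness of outputs\<close>

lemma concat_vec_simps [simp]:
  "concat_vec [] = 0\<^sub>v 0" "concat_vec (v # vs) = v @\<^sub>v concat_vec vs"
  by (simp_all add: concat_vec_def)

lemma concat_vec_carrier:
  "list_all2 (\<lambda>v d. v \<in> carrier_vec d) vs ds \<Longrightarrow> concat_vec vs \<in> carrier_vec (sum_list ds)"
  by (induction rule: list_all2_induct) auto

lemma concat_vec_inj: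
  assumes "list_all2 (\<lambda>v d. v \<in> carrier_vec d) vs ds" "list_all2 (\<lambda>v d. v \<in> carrier_vec d) ws ds"
    and "concat_vec vs = concat_vec ws"
  shows "vs = ws"
  using assms
proof (induction ds arbitrary: vs ws rule: list.induct)
  case Nil
  have "vs = []" using Nil(1) by (rule list_all2_Nil2[THEN iffD1])
  moreover have "ws = []" using Nil(2) by (rule list_all2_Nil2[THEN iffD1])
  ultimately show ?case by simp
next
  case (Cons d ds)
  then obtain v vs' w ws' where "vs = v # vs'" "ws = w # ws'"
    "v \<in> carrier_vec d" "w \<in> carrier_vec d"
    "list_all2 (\<lambda>v d. v \<in> carrier_vec d) vs' ds" "list_all2 (\<lambda>v d. v \<in> carrier_vec d) ws' ds"
    by (auto simp: list_all2_Cons2)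
  with Cons show ?case
    by (metis append_vec_eq concat_vec_simps(2))
qed

lemma ex_split_vec:
  "z \<in> carrier_vec (sum_list ds) \<Longrightarrow>
     \<exists>vs. list_all2 (\<lambda>v d. v \<in> carrier_vec d) vs ds \<and> concat_vec vs = (z :: real vec)"
proof (induction ds arbitrary: z)
  case Nil
  then show ?case by auto
next
  case (Cons d ds)
  let ?m = "sum_list ds"
  from Cons obtain vs where
    "list_all2 (\<lambda>v d. v \<in> carrier_vec d) vs ds" "concat_vec vs = vec_last z ?m"
    by (meson vec_last_carrier)
  with Cons.prems show ?case
    by (intro exI[of _ "vec_first z d # vs"]) auto
qed

context
  fixes N E S
  assumes sys: "distributed_system N E S"
begin

lemma nbrs:
  "finite {i. (i, k) \<in> E}" "finite {j. (k, j) \<in> E}"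
  "set (in_nbrs E k) = {i. (i, k) \<in> E}" "set (out_nbrs E k) = {j. (k, j) \<in> E}"
  "distinct (out_nbrs E k)"
proof -
  have E: "E \<subseteq> nodes N \<times> nodes N" using sys by (simp add: distributed_system_def)
  show 1: "finite {i. (i, k) \<in> E}" by (rule finite_subset[of _ "nodes N"]) (use E in auto)
  show 2: "finite {j. (k, j) \<in> E}" by (rule finite_subset[of _ "nodes N"]) (use E in auto)
  show "set (in_nbrs E k) = {i. (i, k) \<in> E}" "set (out_nbrs E k) = {j. (k, j) \<in> E}"
    "distinct (out_nbrs E k)"
    using 1 2 by (simp_all add: in_nbrs_def out_nbrs_def)
qed

lemma list_all2_in:
  assumes "k \<in> nodes N" "\<forall>k \<in> nodes N. x k t \<in> carrier_vec (tdim S k t)"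
    "\<forall>e \<in> E. xs e t \<in> carrier_vec (sdim S e t)"
  shows "list_all2 (\<lambda>v d. v \<in> carrier_vec d) (at_in E x xs k t) (in_dims E S k t)"
  using assms by (auto simp: at_in_def list_all2_map1 list_all2_map2 nbrs intro!: list_all2_same[THEN iffD2])

lemma list_all2_out:
  assumes "k \<in> nodes N" "\<forall>k \<in> nodes N. x k t \<in> carrier_vec (tdim S k t)"
    "\<forall>e \<in> E. xs e t \<in> carrier_vec (sdim S e t)"
  shows "list_all2 (\<lambda>v d. v \<in> carrier_vec d) (at_out E x xs k t) (out_dims E S k t)"
  using assms by (auto simp: at_out_def list_all2_map1 list_all2_map2 nbrs intro!: list_all2_same[THEN iffD2])

lemma io_map_unique:
  assumes "(u, y) \<in> io_map N E S" "(u, z) \<in> io_map N E S" "k \<in> nodes N"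
  shows "y k t = z k t"
proof -
  have E: "E \<subseteq> nodes N \<times> nodes N" using sys by (simp add: distributed_system_def)
  from assms obtain x xs x' xs' where
    1: "is_trajectory N E S u x xs y" and 2: "is_trajectory N E S u x' xs' z"
    by (auto simp: io_map_def)
  have at_in_eq: "at_in E x xs k t = at_in E x' xs' k t"
    if "\<forall>k \<in> nodes N. x k t = x' k t" "\<forall>e \<in> E. xs e t = xs' e t" "k \<in> nodes N" for k t
    using that by (auto simp: at_in_def nbrs)
  have "(\<forall>k \<in> nodes N. x k t = x' k t) \<and> (\<forall>e \<in> E. xs e t = xs' e t)" for t
  proof (induction t)
    case 0
    then show ?case using 1 2 by (simp add: is_trajectory_def)
  next
    case (Suc t)
    have eq: "at_out E x xs k (Suc t) = at_out E x' xs' k (Suc t)" if k: "k \<in> nodes N" for k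
    proof (rule concat_vec_inj)
      show "list_all2 (\<lambda>v d. v \<in> carrier_vec d) (at_out E x xs k (Suc t)) (out_dims E S k (Suc t))"
        using 1 by (intro list_all2_out k) (auto simp: is_trajectory_def is_signal_def)
      show "list_all2 (\<lambda>v d. v \<in> carrier_vec d) (at_out E x' xs' k (Suc t)) (out_dims E S k (Suc t))"
        using 2 by (intro list_all2_out k) (auto simp: is_trajectory_def is_signal_def)
      show "concat_vec (at_out E x xs k (Suc t)) = concat_vec (at_out E x' xs' k (Suc t))"
        using 1 2 k at_in_eq[OF _ _ k, of t] Suc by (simp add: is_trajectory_def)
    qed
    show ?case
    proof (intro conjI ballI)
      fix k assume "k \<in> nodes N"
      from eq[OF this] show "x k (Suc t) = x' k (Suc t)" by (simp add: at_out_def)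
    next
      fix e assume e: "e \<in> E"
      then obtain i j where ij: "e = (i, j)" "i \<in> nodes N" using E by auto
      from eq[OF ij(2)] show "xs e (Suc t) = xs' e (Suc t)"
        using e ij nbrs(4)[of i] by (simp add: at_out_def)
    qed
  qed
  then show ?thesis
    using 1 2 assms(3) at_in_eq[OF _ _ assms(3), of t] by (simp add: is_trajectory_def)
qed

lemma io_map_total:
  assumes u: "is_signal N (udim S) u"
  shows "\<exists>y. (u, y) \<in> io_map N E S"
proof -
  have E: "E \<subseteq> nodes N \<times> nodes N" using sys by (simp add: distributed_system_def)
  define step where "step = (\<lambda>t (p :: (nat \<Rightarrow> real vec) \<times> (nat \<times> nat \<Rightarrow> real vec)) k.
    Amat S k t *\<^sub>v concat_vec (at_in E (\<lambda>k _. fst p k) (\<lambda>e _. snd p e) k t) + Bmat S k t *\<^sub>v u k t)"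
  define ok where "ok = (\<lambda>t (p :: (nat \<Rightarrow> real vec) \<times> (nat \<times> nat \<Rightarrow> real vec)).
    (\<forall>k \<in> nodes N. fst p k \<in> carrier_vec (tdim S k t)) \<and>
    (\<forall>e \<in> E. snd p e \<in> carrier_vec (sdim S e t)) \<and>
    (t = 0 \<longrightarrow> p = (\<lambda>k. 0\<^sub>v (tdim S k 0), \<lambda>e. 0\<^sub>v (sdim S e 0))))"
  define nxt where "nxt = (\<lambda>t p (q :: (nat \<Rightarrow> real vec) \<times> (nat \<times> nat \<Rightarrow> real vec)).
    \<forall>k \<in> nodes N. concat_vec (at_out E (\<lambda>k _. fst q k) (\<lambda>e _. snd q e) k (Suc t)) = step t p k)"
  have "\<exists>f. \<forall>t. ok t (f t) \<and> nxt t (f t) (f (Suc t))"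
  proof (rule dependent_nat_choice)
    show "\<exists>p. ok 0 p" by (auto simp: ok_def)
  next
    fix p t assume ok: "ok t p"
    have "\<exists>vs. list_all2 (\<lambda>v d. v \<in> carrier_vec d) vs (out_dims E S k (Suc t)) \<and>
        concat_vec vs = step t p k" if k: "k \<in> nodes N" for k
    proof (rule ex_split_vec)
      have "concat_vec (at_in E (\<lambda>k _. fst p k) (\<lambda>e _. snd p e) k t)
          \<in> carrier_vec (sum_list (in_dims E S k t))"
        using ok by (intro concat_vec_carrier list_all2_in k) (auto simp: ok_def)
      then show "step t p k \<in> carrier_vec (sum_list (out_dims E S k (Suc t)))"
        using sys k u unfolding step_def distributed_system_def is_signal_def
        by (metis add_carrier_vec mult_mat_vec_carrier Suc_eq_plus1)
    qed
    then obtain L where L: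
      "\<And>k. k \<in> nodes N \<Longrightarrow> list_all2 (\<lambda>v d. v \<in> carrier_vec d) (L k) (out_dims E S k (Suc t))"
      "\<And>k. k \<in> nodes N \<Longrightarrow> concat_vec (L k) = step t p k"
      by metis
    define q where "q = (\<lambda>k. hd (L k), \<lambda>(i, j). the (map_of (zip (out_nbrs E i) (tl (L i))) j))"
    have q: "at_out E (\<lambda>k _. fst q k) (\<lambda>e _. snd q e) k (Suc t) = L k" if k: "k \<in> nodes N" for k
    proof -
      obtain v vs where Lk: "L k = v # vs" "length vs = length (out_nbrs E k)"
        using L(1)[OF k] by (auto simp: at_out_def list_all2_Cons2 dest: list_all2_lengthD)
      have "map (\<lambda>j. the (map_of (zip (out_nbrs E k) vs) j)) (out_nbrs E k) = vs"
        using Lk(2) nbrs(5)[of k] by (intro nth_equalityI) (auto simp: map_of_zip_nth)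
      then show ?thesis by (simp add: at_out_def q_def Lk)
    qed
    have dims: "list_all2 (\<lambda>v d. v \<in> carrier_vec d)
        (at_out E (\<lambda>k _. fst q k) (\<lambda>e _. snd q e) k (Suc t)) (out_dims E S k (Suc t))"
      if "k \<in> nodes N" for k using L(1) q that by simp
    have "ok (Suc t) q"
      unfolding ok_def
    proof (intro conjI ballI impI)
      fix k assume "k \<in> nodes N"
      from dims[OF this] show "fst q k \<in> carrier_vec (tdim S k (Suc t))" by (simp add: at_out_def)
    next
      fix e assume e: "e \<in> E"
      then obtain i j where ij: "e = (i, j)" "i \<in> nodes N" using E by auto
      from dims[OF ij(2)] show "snd q e \<in> carrier_vec (sdim S e (Suc t))"
        using e ij nbrs(4)[of i]
        by (auto simp: at_out_def list_all2_map1 list_all2_map2 list_all2_same)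
    qed simp
    moreover have "nxt t p q" using q L(2) by (simp add: nxt_def)
    ultimately show "\<exists>q. ok (Suc t) q \<and> nxt t p q" by blast
  qed
  then obtain f where f: "\<And>t. ok t (f t)" "\<And>t. nxt t (f t) (f (Suc t))" by blast
  define x where "x = (\<lambda>k t. fst (f t) k)"
  define xs where "xs = (\<lambda>e t. snd (f t) e)"
  define y where "y = (\<lambda>k t. Cmat S k t *\<^sub>v concat_vec (at_in E x xs k t) + Dmat S k t *\<^sub>v u k t)"
  have x: "\<forall>k \<in> nodes N. x k t \<in> carrier_vec (tdim S k t)"
    "\<forall>e \<in> E. xs e t \<in> carrier_vec (sdim S e t)" for t
    using f(1)[of t] by (auto simp: ok_def x_def xs_def)
  have "is_trajectory N E S u x xs y"
    unfolding is_trajectory_def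
  proof (intro conjI ballI allI)
    show "is_signal N (udim S) u" by fact
    show "is_signal N (tdim S) x" using x by (simp add: is_signal_def)
    show "is_signal N (ydim S) y"
      unfolding is_signal_def
    proof (intro ballI allI)
      fix k t assume k: "k \<in> nodes N"
      have "Cmat S k t \<in> carrier_mat (ydim S k t) (sum_list (in_dims E S k t))"
        "Dmat S k t \<in> carrier_mat (ydim S k t) (udim S k t)" "u k t \<in> carrier_vec (udim S k t)"
        using sys k u by (auto simp: distributed_system_def is_signal_def)
      then show "y k t \<in> carrier_vec (ydim S k t)"
        unfolding y_def
        using concat_vec_carrier[OF list_all2_in[of k x t xs, OF k x(1) x(2)]]
        by (metis add_carrier_vec mult_mat_vec_carrier)
    qed
    show "xs e t \<in> carrier_vec (sdim S e t)" if "e \<in> E" for e t using x that by blast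
    show "x k 0 = 0\<^sub>v (tdim S k 0)" for k using f(1)[of 0] by (simp add: ok_def x_def)
    show "xs e 0 = 0\<^sub>v (sdim S e 0)" for e using f(1)[of 0] by (simp add: ok_def xs_def)
    show "concat_vec (at_out E x xs k (t+1)) =
        Amat S k t *\<^sub>v concat_vec (at_in E x xs k t) + Bmat S k t *\<^sub>v u k t" if "k \<in> nodes N" for k t
      using f(2)[of t] that by (simp add: nxt_def step_def at_in_def at_out_def x_def xs_def)
  qed (simp add: y_def)
  then show ?thesis by (auto simp: io_map_def)
qed

end

end

theory Submission
  imports Defs "HOL-Analysis.L2_Norm"
begin

text \<open>Put a truncated state to zero instead of deleting it, so that all partially truncated systems live
  on the same state space, and truncate the node and edge states one node or edge at a time. Let \<open>z'\<close>,
  \<open>z\<close> be the states before and after such a step, driven by the same input, and \<open>w\<close> the scalar sequence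
  of the truncated block. The observability inequality applied to \<open>z' - z\<close> and the controllability
  inequality applied to \<open>z' + z\<close> make \<open>a \<Sum>\<sigma>(z' - z)\<^sup>2 + c \<Sum>(z' + z)\<^sup>2/\<sigma>\<close> a storage function for the
  supply rate \<open>4 c |u|\<^sup>2 - a |e|\<^sup>2\<close>, provided that \<open>a\<close> and \<open>c\<close> are nonincreasing in time and \<open>c = a w\<^sup>2\<close>
  whenever truncation occurs; monotonicity of \<open>w\<close> is what allows such a choice. Hence each step costs at
  most \<open>2 sup w\<close>, and the triangle inequality adds up the steps. The margin \<open>\<beta>\<close> in the controllability
  inequality yields a factor less than one, and with it strictness.\<close>

section \<open>The storage function of a truncation step\<close>

text \<open>Any two partially truncated systems obey the update of the full realization followed by
  zeroing coordinates. So the inequalities of the original realization serve every step, and no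
  intermediate system has to be shown balanced; blocks truncated earlier vanish in both trajectories
  and can only lose storage. The obstacle is time variation: \<open>c = a w^2\<close> fixes the
  ratio of the weights at truncation times, while dissipation forbids either weight to grow. A
  nondecreasing \<open>w\<close> is absorbed by letting \<open>a\<close> fall, a nonincreasing one
  by letting \<open>c\<close> fall. One pair of weights fits one sequence only, which is why the
  blocks are removed separately. The input cancels in \<open>z' - z\<close> and doubles in
  \<open>z' + z\<close>; this is the origin of the 4 in the supply rate and of the 2 in the bound.
  Strictness has to be uniform in the input, since a supremum of strictly smaller ratios may still
  attain the bound. The uniform factor is \<rho> = 1 - \<beta>/M, where M bounds all gramian
  entries.\<close>

lemma monotone_weights:
  fixes w :: "nat \<Rightarrow> real"
  assumes mono: "mono_on F w \<or> antimono_on F w"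
    and w: "\<And>t. t \<in> F \<Longrightarrow> 0 < w t" "\<And>t. t \<in> F \<Longrightarrow> w t \<le> W" and W: "0 \<le> W"
  obtains a c :: "nat \<Rightarrow> real" where "decseq a" "decseq c" "\<And>t. 1 \<le> a t" "\<And>t. 0 \<le> c t"
    "\<And>t. c t \<le> W^2" "\<And>t. t \<in> F \<Longrightarrow> c t = a t * (w t)^2"
  using mono
proof
  assume mono: "mono_on F w"
  define nxt where "nxt t = (LEAST s. s \<in> F \<and> t \<le> s)" for t
  \<comment> \<open>With \<open>c\<close> constantly \<open>W^2\<close>, the required relation
    forces \<open>a = W^2 / w^2\<close> on \<open>F\<close>, which falls because \<open>w\<close>
    rises. Between truncation times \<open>a\<close> takes the value of the next one; after the last
    it drops to 1, the least value allowed.\<close>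
  define a where "a t = (if \<exists>s\<in>F. t \<le> s then W^2 / (w (nxt t))^2 else 1)" for t
  have nxt: "nxt t \<in> F \<and> t \<le> nxt t" if "\<exists>s\<in>F. t \<le> s" for t
    unfolding nxt_def by (rule LeastI_ex) (use that in auto)
  have nxt_le: "nxt t \<le> s" if "s \<in> F" "t \<le> s" for t s
    unfolding nxt_def by (rule Least_le) (use that in auto)
  have ge: "1 \<le> W^2 / (w s)^2" if "s \<in> F" for s
    using w[OF that] by (simp add: power_mono)
  show thesis
  proof (rule that)
    show a1: "1 \<le> a t" for t using ge nxt by (auto simp: a_def)
    show "decseq a"
    proof (rule antimonoI)
      fix s t :: nat assume st: "s \<le> t"
      show "a t \<le> a s"
      proof (cases "\<exists>q\<in>F. t \<le> q")
        case True
        then have ex: "\<exists>q\<in>F. s \<le> q" using st by (meson order_trans)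
        have "nxt s \<le> nxt t" using nxt[OF True] st by (intro nxt_le) auto
        then have "w (nxt s) \<le> w (nxt t)"
          using mono nxt[OF True] nxt[OF ex] by (auto simp: mono_on_def)
        then have "(w (nxt s))^2 \<le> (w (nxt t))^2" "0 < (w (nxt s))^2"
          using w(1)[of "nxt s"] nxt[OF ex] by (auto intro!: power_mono)
        then show ?thesis
          using True ex by (auto simp: a_def intro!: divide_left_mono mult_pos_pos)
      next
        case False
        then show ?thesis using a1 by (simp add: a_def)
      qed
    qed
    show "W^2 = a t * (w t)^2" if t: "t \<in> F" for t
    proof -
      have "nxt t = t" using nxt[of t] nxt_le[of t t] t by force
      then show ?thesis using t w(1)[OF t] by (auto simp: a_def)
    qed
  qed (use W in \<open>auto intro: decseq_const\<close>)
next
  assume anti: "antimono_on F w"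
  \<comment> \<open>With \<open>a = 1\<close> the relation forces \<open>c = w^2\<close> on
    \<open>F\<close>. The running minimum extends this to all times, and \<open>W^2\<close> is its
    value before the first truncation.\<close>
  define c where "c t = Min (insert (W^2) ((\<lambda>s. (w s)^2) ` {s \<in> F. s \<le> t}))" for t
  have fin: "finite {s \<in> F. s \<le> t}" for t by simp
  show thesis
  proof (rule that[of "\<lambda>_. 1" c])
    show "decseq c"
      unfolding c_def by (intro antimonoI Min_antimono) (auto simp: finite_subset)
    show "0 \<le> c t" for t unfolding c_def by (subst Min_ge_iff) auto
    show "c t \<le> W^2" for t unfolding c_def by (rule Min_le) auto
    show "c t = 1 * (w t)^2" if t: "t \<in> F" for t
    proof -
      have "(w t)^2 \<le> (w s)^2" if "s \<in> F" "s \<le> t" for s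
        using anti w(1) t that by (intro power_mono) (auto simp: monotone_on_def less_imp_le)
      moreover have "(w t)^2 \<le> W^2" using w[OF t] by (intro power_mono) auto
      ultimately have "c t = (w t)^2" unfolding c_def using t by (intro Min_eqI) auto
      then show ?thesis by simp
    qed
  qed (auto intro: decseq_const)
qed

text \<open>\<open>p\<close> and \<open>p'\<close> are the successor states before truncation. The weights \<open>a\<close>, \<open>c\<close> are chosen such
  that setting a coordinate of \<open>p\<close> to zero does not increase the Lyapunov function
  \<open>a \<Sum>\<sigma>(z' - z)\<^sup>2 + c \<Sum>(z' + z)\<^sup>2/\<sigma>\<close>: if \<open>c = a \<sigma>\<^sup>2\<close> the cross terms of the two squares cancel.\<close>

lemma truncation_energy_bound:
  fixes z z' p p' \<sigma> :: "nat \<Rightarrow> 'i \<Rightarrow> real" and e U a c :: "nat \<Rightarrow> real"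
  assumes \<sigma>: "\<And>t i. i \<in> I t \<Longrightarrow> 0 < \<sigma> t i"
    and init: "\<And>i. i \<in> I 0 \<Longrightarrow> z' 0 i = 0" "\<And>i. i \<in> I 0 \<Longrightarrow> z 0 i = 0"
    and a: "decseq a" "\<And>t. 1 \<le> a t" and c: "decseq c" "\<And>t. 0 \<le> c t" "\<And>t. c t \<le> W^2"
    and nonneg: "\<And>t. 0 \<le> e t" "\<And>t. 0 \<le> U t" "0 \<le> \<rho>" "\<rho> \<le> 1"
    and trunc: "\<And>t i. i \<in> I (Suc t) \<Longrightarrow>
      z' (Suc t) i = p' t i \<and> z (Suc t) i = p t i \<or> z' (Suc t) i = 0 \<and> z (Suc t) i = 0 \<or>
      z' (Suc t) i = p' t i \<and> z (Suc t) i = 0 \<and> c (Suc t) = a (Suc t) * (\<sigma> (Suc t) i)^2"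
    and O: "\<And>t. (\<Sum>i\<in>I (Suc t). \<sigma> (Suc t) i * (p' t i - p t i)^2) + e t
      \<le> (\<Sum>i\<in>I t. \<sigma> t i * (z' t i - z t i)^2)"
    and C: "\<And>t. (\<Sum>i\<in>I (Suc t). (p' t i + p t i)^2 / \<sigma> (Suc t) i)
      \<le> \<rho> * ((\<Sum>i\<in>I t. (z' t i + z t i)^2 / \<sigma> t i) + 4 * U t)"
  shows "(\<Sum>t<n. e t) \<le> 4 * \<rho> * W^2 * (\<Sum>t<n. U t)"
proof -
  define Vo where "Vo t = (\<Sum>i\<in>I t. \<sigma> t i * (z' t i - z t i)^2)" for t
  define Vc where "Vc t = (\<Sum>i\<in>I t. (z' t i + z t i)^2 / \<sigma> t i)" for t
  have pos: "0 \<le> Vo t" "0 \<le> Vc t" for t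
    using \<sigma> unfolding Vo_def Vc_def by (auto intro!: sum_nonneg simp: less_imp_le)
  have coord: "a (Suc t) * (\<sigma> (Suc t) i * (z' (Suc t) i - z (Suc t) i)^2)
        + c (Suc t) * ((z' (Suc t) i + z (Suc t) i)^2 / \<sigma> (Suc t) i)
      \<le> a (Suc t) * (\<sigma> (Suc t) i * (p' t i - p t i)^2)
        + c (Suc t) * ((p' t i + p t i)^2 / \<sigma> (Suc t) i)" (is "?l \<le> ?r") if i: "i \<in> I (Suc t)" for t i
    using trunc[OF i]
  proof (elim disjE conjE)
    have s: "0 < \<sigma> (Suc t) i" "0 \<le> a (Suc t)" "0 \<le> c (Suc t)"
      using \<sigma>[OF i] a(2)[of "Suc t"] c(2) by auto
    then have r: "0 \<le> ?r" by simp
    {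
      assume "z' (Suc t) i = 0" "z (Suc t) i = 0"
      then show ?thesis using r by simp
    next
      assume z: "z' (Suc t) i = p' t i" "z (Suc t) i = 0"
        and ca: "c (Suc t) = a (Suc t) * (\<sigma> (Suc t) i)^2"
      have cq: "c (Suc t) * (q / \<sigma> (Suc t) i) = a (Suc t) * (\<sigma> (Suc t) i * q)" for q
        using s(1) by (simp add: ca power2_eq_square)
      then have "?r - ?l = 2 * a (Suc t) * \<sigma> (Suc t) i * (p t i)^2"
        unfolding z cq by (simp add: algebra_simps power2_eq_square)
      then show ?thesis using s by (smt (verit) mult_nonneg_nonneg zero_le_power2)
    }
  qed simp
  have step: "a (Suc t) * Vo (Suc t) + c (Suc t) * Vc (Suc t) + e t
      \<le> a t * Vo t + c t * Vc t + 4 * \<rho> * W^2 * U t" for t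
  proof -
    have "a (Suc t) * Vo (Suc t) + c (Suc t) * Vc (Suc t)
        \<le> a (Suc t) * (\<Sum>i\<in>I (Suc t). \<sigma> (Suc t) i * (p' t i - p t i)^2)
          + c (Suc t) * (\<Sum>i\<in>I (Suc t). (p' t i + p t i)^2 / \<sigma> (Suc t) i)"
      unfolding Vo_def Vc_def sum_distrib_left sum.distrib[symmetric] by (rule sum_mono) (rule coord)
    also have "\<dots> \<le> a (Suc t) * (Vo t - e t) + c (Suc t) * (\<rho> * (Vc t + 4 * U t))"
      using O[of t] C[of t] a(2)[of "Suc t"] c(2)
      by (intro add_mono mult_left_mono) (auto simp: Vo_def Vc_def)
    \<comment> \<open>The factor \<open>\<rho>\<close> is given away on the stored energy but kept
      on the supplied energy, where it later becomes the strict factor.\<close>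
    also have "c (Suc t) * (\<rho> * (Vc t + 4 * U t)) \<le> c t * Vc t + 4 * \<rho> * W^2 * U t"
    proof -
      have "c (Suc t) * \<rho> \<le> c t * 1"
        using decseq_SucD[OF c(1), of t] c(2) nonneg by (intro mult_mono) auto
      then have "c (Suc t) * \<rho> * Vc t \<le> c t * 1 * Vc t" using pos(2) by (rule mult_right_mono)
      moreover have "c (Suc t) * (\<rho> * (4 * U t)) \<le> W^2 * (\<rho> * (4 * U t))"
        using c(3) nonneg by (intro mult_right_mono) auto
      ultimately show ?thesis by (simp add: algebra_simps)
    qed
    \<comment> \<open>Here \<open>1 \<le> a\<close> is what makes the output energy count with
      weight at least one.\<close>
    also have "a (Suc t) * (Vo t - e t) \<le> a t * Vo t - e t"
    proof -
      have "a (Suc t) * Vo t \<le> a t * Vo t"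
        using decseq_SucD[OF a(1), of t] pos(1) by (rule mult_right_mono)
      moreover have "1 * e t \<le> a (Suc t) * e t" using a(2) nonneg(1) by (rule mult_right_mono)
      ultimately show ?thesis by (simp add: algebra_simps)
    qed
    finally show ?thesis by simp
  qed
  have "a n * Vo n + c n * Vc n + (\<Sum>t<n. e t) \<le> 4 * \<rho> * W^2 * (\<Sum>t<n. U t)"
  proof (induction n)
    case 0
    then show ?case using init by (simp add: Vo_def Vc_def)
  next
    case (Suc n)
    then show ?case using step[of n] by (simp add: algebra_simps)
  qed
  moreover have "0 \<le> a n * Vo n + c n * Vc n"
    using pos a(2)[of n] c(2) by (intro add_nonneg_nonneg mult_nonneg_nonneg) auto
  ultimately show ?thesis by linarith
qed

section \<open>Lyapunov inequalities evaluated on vectors\<close>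

lemma diagonal_quadratic_form:
  fixes M :: "real mat"
  assumes "M \<in> carrier_mat n n" "diagonal_mat M" "v \<in> carrier_vec n"
  shows "v \<bullet> (M *\<^sub>v v) = (\<Sum>i<n. M $$ (i,i) * (v $ i)^2)"
proof -
  have "(M *\<^sub>v v) $ i = M $$ (i,i) * v $ i" if i: "i < n" for i
  proof -
    have "(M *\<^sub>v v) $ i = (\<Sum>j\<in>{0..<n}. M $$ (i,j) * v $ j)"
      using assms i by (auto simp: scalar_prod_def)
    also have "\<dots> = (\<Sum>j\<in>{0..<n}. if j = i then M $$ (i,i) * v $ i else 0)"
      using assms i by (intro sum.cong) (auto simp: diagonal_mat_def)
    finally show ?thesis using i by simp
  qed
  then show ?thesis
    using assms unfolding scalar_prod_def
    by (auto simp: power2_eq_square algebra_simps lessThan_atLeast0 intro!: sum.cong)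
qed

lemma scalar_prod_self: "v \<bullet> v = (\<Sum>i<dim_vec v. (v $ i :: real)^2)"
  by (simp add: scalar_prod_def power2_eq_square lessThan_atLeast0)

lemma quadratic_form_congruence:
  fixes A M :: "real mat"
  assumes A: "A \<in> carrier_mat n m" and M: "M \<in> carrier_mat m m" and v: "v \<in> carrier_vec n"
  shows "v \<bullet> ((A * M * A\<^sup>T) *\<^sub>v v) = (A\<^sup>T *\<^sub>v v) \<bullet> (M *\<^sub>v (A\<^sup>T *\<^sub>v v))"
proof -
  have At: "A\<^sup>T \<in> carrier_mat m n" using A by simp
  have AM: "A * M \<in> carrier_mat n m" and w: "A\<^sup>T *\<^sub>v v \<in> carrier_vec m" using A M At v by auto
  then have Mw: "M *\<^sub>v (A\<^sup>T *\<^sub>v v) \<in> carrier_vec m" using M by auto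
  have "(A * M * A\<^sup>T) *\<^sub>v v = (A * M) *\<^sub>v (A\<^sup>T *\<^sub>v v)"
    by (rule assoc_mult_mat_vec[OF AM At v])
  also have "\<dots> = A *\<^sub>v (M *\<^sub>v (A\<^sup>T *\<^sub>v v))" by (rule assoc_mult_mat_vec[OF A M w])
  finally show ?thesis
    using transpose_vec_mult_scalar[OF A Mw v] by simp
qed

lemma quadratic_form_gram:
  fixes A :: "real mat"
  assumes A: "A \<in> carrier_mat n m" and v: "v \<in> carrier_vec n"
  shows "v \<bullet> ((A * A\<^sup>T) *\<^sub>v v) = (A\<^sup>T *\<^sub>v v) \<bullet> (A\<^sup>T *\<^sub>v v)"
proof -
  have "A * 1\<^sub>m m * A\<^sup>T = A * A\<^sup>T" using A by simp
  then show ?thesis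
    using quadratic_form_congruence[OF A, of "1\<^sub>m m" v] A v by simp
qed

lemma loewner_less_scalar_bound:
  assumes "X \<prec>\<^sub>L b \<cdot>\<^sub>m 1\<^sub>m n" "X \<in> carrier_mat n n" "v \<in> carrier_vec n"
  shows "v \<bullet> (X *\<^sub>v v) \<le> b * (v \<bullet> v)"
proof (cases "v = 0\<^sub>v n")
  case True
  then show ?thesis using assms(2) by simp
next
  case False
  with assms have "0 < v \<bullet> ((b \<cdot>\<^sub>m 1\<^sub>m n - X) *\<^sub>v v)"
    by (auto simp: loewner_less_def pos_def_def)
  also have "(b \<cdot>\<^sub>m 1\<^sub>m n - X) *\<^sub>v v = b \<cdot>\<^sub>v v - X *\<^sub>v v"
    using assms(2,3) by (subst minus_mult_distrib_mat_vec[of _ n n]) auto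
  also have "v \<bullet> \<dots> = b * (v \<bullet> v) - v \<bullet> (X *\<^sub>v v)"
    using assms(2,3) by (subst scalar_prod_minus_distrib[of _ n]) auto
  finally show ?thesis by simp
qed

lemma quadratic_form_diff_add:
  fixes P Q R :: "real mat"
  assumes P: "P \<in> carrier_mat n n" and Q: "Q \<in> carrier_mat n n" and R: "R \<in> carrier_mat n n"
    and v: "v \<in> carrier_vec n"
  shows "v \<bullet> ((P - Q + R) *\<^sub>v v) = v \<bullet> (P *\<^sub>v v) - v \<bullet> (Q *\<^sub>v v) + v \<bullet> (R *\<^sub>v v)"
proof -
  have "(P - Q + R) *\<^sub>v v = (P - Q) *\<^sub>v v + R *\<^sub>v v"
    using P Q R v by (intro add_mult_distrib_mat_vec) auto
  also have "(P - Q) *\<^sub>v v = P *\<^sub>v v - Q *\<^sub>v v"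
    by (rule minus_mult_distrib_mat_vec[OF P Q v])
  finally have "v \<bullet> ((P - Q + R) *\<^sub>v v) = v \<bullet> (P *\<^sub>v v - Q *\<^sub>v v + R *\<^sub>v v)" by simp
  also have "\<dots> = v \<bullet> (P *\<^sub>v v - Q *\<^sub>v v) + v \<bullet> (R *\<^sub>v v)"
    using P Q R v by (intro scalar_prod_add_distrib[of _ n]) auto
  also have "v \<bullet> (P *\<^sub>v v - Q *\<^sub>v v) = v \<bullet> (P *\<^sub>v v) - v \<bullet> (Q *\<^sub>v v)"
    using P Q v by (intro scalar_prod_minus_distrib[of _ n]) auto
  finally show ?thesis .
qed

lemma observability_inequality:
  fixes A C X Y :: "real mat"
  assumes A: "A \<in> carrier_mat n m" and C: "C \<in> carrier_mat l m"
    and X: "X \<in> carrier_mat m m" "diagonal_mat X" and Y: "Y \<in> carrier_mat n n" "diagonal_mat Y"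
    and lyap: "A\<^sup>T * Y * A - X + C\<^sup>T * C \<prec>\<^sub>L (- \<beta>) \<cdot>\<^sub>m 1\<^sub>m m" and \<beta>: "0 \<le> \<beta>"
    and v: "v \<in> carrier_vec m"
  shows "(\<Sum>i<n. Y $$ (i,i) * ((A *\<^sub>v v) $ i)^2) + (C *\<^sub>v v) \<bullet> (C *\<^sub>v v) \<le> (\<Sum>i<m. X $$ (i,i) * (v $ i)^2)"
proof -
  have AYA: "A\<^sup>T * Y * A \<in> carrier_mat m m" and CC: "C\<^sup>T * C \<in> carrier_mat m m"
    using A C Y by auto
  have "v \<bullet> ((A\<^sup>T * Y * A - X + C\<^sup>T * C) *\<^sub>v v) \<le> - \<beta> * (v \<bullet> v)"
    using AYA CC X by (intro loewner_less_scalar_bound[OF lyap _ v]) auto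
  also have "\<dots> \<le> 0" using \<beta> by (simp add: scalar_prod_self sum_nonneg)
  also have "v \<bullet> ((A\<^sup>T * Y * A - X + C\<^sup>T * C) *\<^sub>v v)
      = v \<bullet> ((A\<^sup>T * Y * A) *\<^sub>v v) - v \<bullet> (X *\<^sub>v v) + v \<bullet> ((C\<^sup>T * C) *\<^sub>v v)"
    by (rule quadratic_form_diff_add[OF AYA X(1) CC v])
  also have "v \<bullet> ((A\<^sup>T * Y * A) *\<^sub>v v) = (A *\<^sub>v v) \<bullet> (Y *\<^sub>v (A *\<^sub>v v))"
    using quadratic_form_congruence[of "A\<^sup>T" m n Y v] A Y v by simp
  also have "v \<bullet> ((C\<^sup>T * C) *\<^sub>v v) = (C *\<^sub>v v) \<bullet> (C *\<^sub>v v)"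
    using quadratic_form_gram[of "C\<^sup>T" m l v] C v by simp
  also have "v \<bullet> (X *\<^sub>v v) = (\<Sum>i<m. X $$ (i,i) * (v $ i)^2)"
    using X v by (rule diagonal_quadratic_form)
  also have "(A *\<^sub>v v) \<bullet> (Y *\<^sub>v (A *\<^sub>v v)) = (\<Sum>i<n. Y $$ (i,i) * ((A *\<^sub>v v) $ i)^2)"
    using A v Y by (intro diagonal_quadratic_form) auto
  finally show ?thesis by simp
qed

text \<open>The gap between the two sides is a square divided by \<open>k * s\<close>. In the
  application \<open>k\<close> is 1 - \<beta>/M: the first terms then sum to at most the quantity
  being estimated, and the second terms carry the contraction factor.\<close>

lemma weighted_young:
  fixes a x s k :: real
  assumes "0 < s" "0 < k"
  shows "2 * (a * x) \<le> s * a^2 / k + k * (x^2 / s)"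
proof -
  have "s * a^2 / k + k * (x^2 / s) - 2 * (a * x) = (s * a - k * x)^2 / (k * s)"
    using assms by (simp add: field_simps power2_eq_square)
  then show ?thesis using assms by (smt (verit) divide_nonneg_pos mult_pos_pos zero_le_power2)
qed

text \<open>With \<open>p = A v + B u\<close> and \<open>q = Y\<^sup>-\<^sup>1 p\<close> the left-hand side is \<open>q \<bullet> p = A\<^sup>T q \<bullet> v + B\<^sup>T q \<bullet> u\<close>;
  Young's inequality then brings in \<open>q \<bullet> (A X A\<^sup>T + B B\<^sup>T) q \<le> (1 - \<beta>/M) q \<bullet> Y q\<close>.\<close>

lemma controllability_inequality:
  fixes A B X Y :: "real mat"
  assumes A: "A \<in> carrier_mat n m" and B: "B \<in> carrier_mat n l"
    and X: "X \<in> carrier_mat m m" "diagonal_mat X" and Y: "Y \<in> carrier_mat n n" "diagonal_mat Y"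
    and posX: "\<And>i. i < m \<Longrightarrow> 0 < X $$ (i,i)" and posY: "\<And>i. i < n \<Longrightarrow> 0 < Y $$ (i,i)"
    and leY: "\<And>i. i < n \<Longrightarrow> Y $$ (i,i) \<le> M"
    and lyap: "A * X * A\<^sup>T - Y + B * B\<^sup>T \<prec>\<^sub>L (- \<beta>) \<cdot>\<^sub>m 1\<^sub>m n" and \<beta>: "0 \<le> \<beta>" "\<beta> < M"
    and v: "v \<in> carrier_vec m" and u: "u \<in> carrier_vec l"
  shows "(\<Sum>i<n. ((A *\<^sub>v v + B *\<^sub>v u) $ i)^2 / Y $$ (i,i))
    \<le> (1 - \<beta> / M) * ((\<Sum>i<m. (v $ i)^2 / X $$ (i,i)) + u \<bullet> u)"
proof -
  define k where "k = 1 - \<beta> / M"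
  have k: "0 < k" using \<beta> by (simp add: k_def)
  define p where "p = A *\<^sub>v v + B *\<^sub>v u"
  have Av: "A *\<^sub>v v \<in> carrier_vec n" and Bu: "B *\<^sub>v u \<in> carrier_vec n" using A B v u by auto
  have p: "p \<in> carrier_vec n" using Av Bu by (simp add: p_def)
  define q where "q = vec n (\<lambda>i. p $ i / Y $$ (i,i))"
  have q: "q \<in> carrier_vec n" by (simp add: q_def)
  define f where "f = A\<^sup>T *\<^sub>v q"
  define g where "g = B\<^sup>T *\<^sub>v q"
  have f: "f \<in> carrier_vec m" and g: "g \<in> carrier_vec l" using A B q by (auto simp: f_def g_def)
  let ?L = "\<Sum>i<n. (p $ i)^2 / Y $$ (i,i)"
  have qY: "(\<Sum>i<n. Y $$ (i,i) * (q $ i)^2) = ?L"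
  proof (rule sum.cong)
    fix i assume "i \<in> {..<n}"
    then show "Y $$ (i,i) * (q $ i)^2 = (p $ i)^2 / Y $$ (i,i)"
      using posY[of i] by (simp add: q_def power2_eq_square)
  qed simp
  have AXA: "A * X * A\<^sup>T \<in> carrier_mat n n" and BB: "B * B\<^sup>T \<in> carrier_mat n n" using A B X by auto
  have "q \<bullet> ((A * X * A\<^sup>T - Y + B * B\<^sup>T) *\<^sub>v q) \<le> - \<beta> * (q \<bullet> q)"
    using AXA BB Y by (intro loewner_less_scalar_bound[OF lyap _ q]) auto
  also have "q \<bullet> ((A * X * A\<^sup>T - Y + B * B\<^sup>T) *\<^sub>v q)
      = q \<bullet> ((A * X * A\<^sup>T) *\<^sub>v q) - q \<bullet> (Y *\<^sub>v q) + q \<bullet> ((B * B\<^sup>T) *\<^sub>v q)"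
    by (rule quadratic_form_diff_add[OF AXA Y(1) BB q])
  also have "q \<bullet> ((A * X * A\<^sup>T) *\<^sub>v q) = f \<bullet> (X *\<^sub>v f)"
    unfolding f_def using A X(1) q by (rule quadratic_form_congruence)
  also have "\<dots> = (\<Sum>i<m. X $$ (i,i) * (f $ i)^2)" using X f by (rule diagonal_quadratic_form)
  also have "q \<bullet> ((B * B\<^sup>T) *\<^sub>v q) = g \<bullet> g" unfolding g_def using B q by (rule quadratic_form_gram)
  also have "q \<bullet> (Y *\<^sub>v q) = ?L" using diagonal_quadratic_form[OF Y q] qY by simp
  finally have 1: "(\<Sum>i<m. X $$ (i,i) * (f $ i)^2) + g \<bullet> g \<le> ?L - \<beta> * (q \<bullet> q)" by simp
  \<comment> \<open>Since the entries of \<open>Y\<close> are at most \<open>M\<close>, the margin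
    \<beta> (q \<bullet> q) is at least the fraction \<beta>/M of \<open>?L\<close>. This makes
    \<open>k\<close> independent of time and dimension.\<close>
  have "?L \<le> (\<Sum>i<n. M * (q $ i)^2)"
    unfolding qY[symmetric] using leY by (intro sum_mono mult_right_mono) auto
  also have "\<dots> = M * (q \<bullet> q)" using q by (simp add: scalar_prod_self sum_distrib_left)
  finally have "\<beta> / M * ?L \<le> \<beta> / M * (M * (q \<bullet> q))" using \<beta> by (intro mult_left_mono) auto
  also have "\<dots> = \<beta> * (q \<bullet> q)" using \<beta> by simp
  finally have 2: "(\<Sum>i<m. X $$ (i,i) * (f $ i)^2) + g \<bullet> g \<le> k * ?L"
    using 1 by (simp add: k_def algebra_simps)
  have "?L = (\<Sum>i<n. q $ i * p $ i)"
    by (rule sum.cong) (auto simp: q_def power2_eq_square)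
  also have "\<dots> = q \<bullet> p" using p by (simp add: scalar_prod_def lessThan_atLeast0)
  also have "\<dots> = q \<bullet> (A *\<^sub>v v) + q \<bullet> (B *\<^sub>v u)"
    unfolding p_def by (rule scalar_prod_add_distrib[OF q Av Bu])
  also have "\<dots> = f \<bullet> v + g \<bullet> u"
    unfolding f_def g_def using transpose_vec_mult_scalar[OF A v q] transpose_vec_mult_scalar[OF B u q] by simp
  finally have "2 * ?L = (\<Sum>i<m. 2 * (f $ i * v $ i)) + (\<Sum>i<l. 2 * (g $ i * u $ i))"
    using v u by (simp add: scalar_prod_def lessThan_atLeast0 sum_distrib_left)
  also have "\<dots> \<le> (\<Sum>i<m. X $$ (i,i) * (f $ i)^2 / k + k * ((v $ i)^2 / X $$ (i,i)))
      + (\<Sum>i<l. 1 * (g $ i)^2 / k + k * ((u $ i)^2 / 1))"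
    using k posX by (intro add_mono sum_mono weighted_young) auto
  also have "\<dots> = ((\<Sum>i<m. X $$ (i,i) * (f $ i)^2) + g \<bullet> g) / k
      + k * ((\<Sum>i<m. (v $ i)^2 / X $$ (i,i)) + u \<bullet> u)"
    using g u by (simp add: scalar_prod_self sum.distrib sum_distrib_left sum_divide_distrib
        add_divide_distrib algebra_simps)
  \<comment> \<open>One of the two copies of \<open>?L\<close> on the left is absorbed here.\<close>
  also have "((\<Sum>i<m. X $$ (i,i) * (f $ i)^2) + g \<bullet> g) / k \<le> ?L"
    using 2 k by (simp add: divide_le_eq mult.commute)
  finally show ?thesis by (simp add: p_def k_def)
qed

section \<open>Coordinates of concatenated blocks\<close>

text \<open>Names of state blocks: \<open>Inl k\<close> is a temporal state, \<open>Inr e\<close> a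
  spatial one. Lists of names rather than of data make it possible to recognize the same block in an
  output list and in an input list.\<close>

definition in_items :: "(nat \<times> nat) set \<Rightarrow> nat \<Rightarrow> (nat + nat \<times> nat) list" where
  "in_items E k = Inl k # map (\<lambda>i. Inr (i, k)) (in_nbrs E k)"

definition out_items :: "(nat \<times> nat) set \<Rightarrow> nat \<Rightarrow> (nat + nat \<times> nat) list" where
  "out_items E k = Inl k # map (\<lambda>j. Inr (k, j)) (out_nbrs E k)"

abbreviation item :: "(nat \<Rightarrow> nat \<Rightarrow> 'a) \<Rightarrow> (nat \<times> nat \<Rightarrow> nat \<Rightarrow> 'a) \<Rightarrow> nat \<Rightarrow> nat + nat \<times> nat \<Rightarrow> 'a" where
  "item f g t \<equiv> case_sum (\<lambda>k. f k t) (\<lambda>e. g e t)"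

lemma at_in_items: "at_in E f g k t = map (item f g t) (in_items E k)"
  by (simp add: at_in_def in_items_def)

lemma at_out_items: "at_out E f g k t = map (item f g t) (out_items E k)"
  by (simp add: at_out_def out_items_def)

lemma concat_vec_map_carrier:
  "(\<And>b. b \<in> set bs \<Longrightarrow> v b \<in> carrier_vec (d b)) \<Longrightarrow> concat_vec (map v bs) \<in> carrier_vec (sum_list (map d bs))"
  by (rule concat_vec_carrier) (auto simp: list_all2_map1 list_all2_map2 intro: list_all2_same[THEN iffD2])

lemma diag_block_mat_carrier:
  "(\<And>b. b \<in> set bs \<Longrightarrow> M b \<in> carrier_mat (d b) (d b)) \<Longrightarrow>
    diag_block_mat (map M bs) \<in> carrier_mat (sum_list (map d bs)) (sum_list (map d bs))"
  by (induction bs) (auto simp: Let_def)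

lemma diagonal_diag_block_mat:
  assumes "\<And>b. b \<in> set bs \<Longrightarrow> M b \<in> carrier_mat (d b) (d b) \<and> diagonal_mat (M b)"
  shows "diagonal_mat (diag_block_mat (map M bs))"
  using assms
proof (induction bs)
  case (Cons b bs)
  have D: "diag_block_mat (map M bs) \<in> carrier_mat (sum_list (map d bs)) (sum_list (map d bs))"
    using Cons.prems by (intro diag_block_mat_carrier) auto
  have M: "M b \<in> carrier_mat (d b) (d b)" "diagonal_mat (M b)" using Cons.prems by auto
  have "diagonal_mat (diag_block_mat (map M bs))" using Cons by auto
  then show ?case
    using M D by (auto simp: Let_def diagonal_mat_def)
qed (auto simp: diagonal_mat_def)

lemma sum_lessThan_add:
  "(\<Sum>p<a + b. f p) = (\<Sum>p<a. f p) + (\<Sum>p<b. f (a + p :: nat) :: 'a :: comm_monoid_add)"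
  by (induction b) (auto simp: algebra_simps)

text \<open>The witness \<open>b\<close>, \<open>i\<close> is the same for all families of truncation orders, vectors and matrices.\<close>

lemma locate_position:
  assumes "p < sum_list (map d bs)"
  shows "\<exists>b\<in>set bs. \<exists>i<d b.
    (\<forall>r. (\<forall>b\<in>set bs. r b \<le> d b) \<longrightarrow> (p \<in> kept (map d bs) (map r bs) \<longleftrightarrow> i < r b)) \<and>
    (\<forall>v. (\<forall>b\<in>set bs. v b \<in> carrier_vec (d b)) \<longrightarrow> concat_vec (map v bs) $ p = v b $ i) \<and>
    (\<forall>M :: 'b \<Rightarrow> real mat. (\<forall>b\<in>set bs. M b \<in> carrier_mat (d b) (d b)) \<longrightarrow>
      diag_block_mat (map M bs) $$ (p, p) = M b $$ (i, i))"
  using assms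
proof (induction bs arbitrary: p)
  case (Cons b0 bs)
  show ?case
  proof (cases "p < d b0")
    case True
    show ?thesis
    proof (intro bexI[of _ b0] exI[of _ p] conjI allI impI)
      fix M :: "'b \<Rightarrow> real mat" assume M: "\<forall>b\<in>set (b0 # bs). M b \<in> carrier_mat (d b) (d b)"
      then have "diag_block_mat (map M bs) \<in> carrier_mat (sum_list (map d bs)) (sum_list (map d bs))"
        by (intro diag_block_mat_carrier) auto
      then show "diag_block_mat (map M (b0 # bs)) $$ (p, p) = M b0 $$ (p, p)"
        using M True by (auto simp: Let_def)
    next
      fix v :: "'b \<Rightarrow> real vec" assume v: "\<forall>b\<in>set (b0 # bs). v b \<in> carrier_vec (d b)"
      then show "concat_vec (map v (b0 # bs)) $ p = v b0 $ p"
        using True by (auto simp: append_vec_def Let_def)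
    qed (use True in auto)
  next
    case False
    define q where "q = p - d b0"
    have p: "p = d b0 + q" and q: "q < sum_list (map d bs)" using False Cons.prems by (auto simp: q_def)
    from Cons.IH[OF q] obtain b i where b: "b \<in> set bs" "i < d b"
      and kept: "\<And>r. (\<forall>b\<in>set bs. r b \<le> d b) \<Longrightarrow> (q \<in> kept (map d bs) (map r bs) \<longleftrightarrow> i < r b)"
      and vec: "\<And>v. (\<forall>b\<in>set bs. v b \<in> carrier_vec (d b)) \<Longrightarrow> concat_vec (map v bs) $ q = v b $ i"
      and mat: "\<And>M :: 'b \<Rightarrow> real mat. (\<forall>b\<in>set bs. M b \<in> carrier_mat (d b) (d b)) \<Longrightarrow>
        diag_block_mat (map M bs) $$ (q, q) = M b $$ (i, i)"
      by blast
    show ?thesis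
    proof (intro bexI[of _ b] exI[of _ i] conjI allI impI)
      fix M :: "'b \<Rightarrow> real mat" assume M: "\<forall>b\<in>set (b0 # bs). M b \<in> carrier_mat (d b) (d b)"
      then have "diag_block_mat (map M bs) \<in> carrier_mat (sum_list (map d bs)) (sum_list (map d bs))"
        by (intro diag_block_mat_carrier) auto
      then show "diag_block_mat (map M (b0 # bs)) $$ (p, p) = M b $$ (i, i)"
        using M q mat[of M] by (auto simp: Let_def p)
    next
      fix v :: "'b \<Rightarrow> real vec" assume v: "\<forall>b\<in>set (b0 # bs). v b \<in> carrier_vec (d b)"
      then have "concat_vec (map v bs) \<in> carrier_vec (sum_list (map d bs))"
        by (intro concat_vec_map_carrier) auto
      then show "concat_vec (map v (b0 # bs)) $ p = v b $ i"
        using v q vec[of v] by (auto simp: p)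
    next
      fix r assume "\<forall>b\<in>set (b0 # bs). r b \<le> d b"
      then show "p \<in> kept (map d (b0 # bs)) (map r (b0 # bs)) \<longleftrightarrow> i < r b"
        using kept[of r] by (auto simp: p)
    qed (use b in auto)
  qed
qed simp

text \<open>Two families of vectors occur together because each storage term couples both
  trajectories with the gramian entry; \<open>\<phi>\<close> stands for either term.\<close>

lemma sum_concat_vec:
  fixes M :: "'b \<Rightarrow> real mat" and \<phi> :: "real \<Rightarrow> real \<Rightarrow> real \<Rightarrow> real"
  assumes "\<And>b. b \<in> set bs \<Longrightarrow> M b \<in> carrier_mat (d b) (d b)"
    "\<And>b. b \<in> set bs \<Longrightarrow> v b \<in> carrier_vec (d b)" "\<And>b. b \<in> set bs \<Longrightarrow> w b \<in> carrier_vec (d b)"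
  shows "(\<Sum>p<sum_list (map d bs). \<phi> (diag_block_mat (map M bs) $$ (p,p))
      (concat_vec (map v bs) $ p) (concat_vec (map w bs) $ p))
    = (\<Sum>b\<leftarrow>bs. \<Sum>i<d b. \<phi> (M b $$ (i,i)) (v b $ i) (w b $ i))"
  using assms
proof (induction bs)
  case (Cons b bs)
  have D: "diag_block_mat (map M bs) \<in> carrier_mat (sum_list (map d bs)) (sum_list (map d bs))"
    using Cons.prems by (intro diag_block_mat_carrier) auto
  have c: "concat_vec (map v bs) \<in> carrier_vec (sum_list (map d bs))"
    "concat_vec (map w bs) \<in> carrier_vec (sum_list (map d bs))"
    using Cons.prems by (auto intro!: concat_vec_map_carrier)
  have b: "M b \<in> carrier_mat (d b) (d b)" "v b \<in> carrier_vec (d b)" "w b \<in> carrier_vec (d b)"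
    using Cons.prems by auto
  have "(\<Sum>p<sum_list (map d bs). \<phi> (diag_block_mat (map M bs) $$ (p,p))
      (concat_vec (map v bs) $ p) (concat_vec (map w bs) $ p))
    = (\<Sum>b\<leftarrow>bs. \<Sum>i<d b. \<phi> (M b $$ (i,i)) (v b $ i) (w b $ i))"
    using Cons.prems by (intro Cons.IH) auto
  moreover have "(\<Sum>p<d b. \<phi> (diag_block_mat (map M (b # bs)) $$ (p,p))
      (concat_vec (map v (b # bs)) $ p) (concat_vec (map w (b # bs)) $ p))
    = (\<Sum>i<d b. \<phi> (M b $$ (i,i)) (v b $ i) (w b $ i))"
    using b c D by (intro sum.cong) (auto simp: Let_def)
  moreover have "(\<Sum>p<sum_list (map d bs). \<phi> (diag_block_mat (map M (b # bs)) $$ (d b + p,d b + p))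
      (concat_vec (map v (b # bs)) $ (d b + p)) (concat_vec (map w (b # bs)) $ (d b + p)))
    = (\<Sum>p<sum_list (map d bs). \<phi> (diag_block_mat (map M bs) $$ (p,p))
      (concat_vec (map v bs) $ p) (concat_vec (map w bs) $ p))"
    using b c D by (intro sum.cong) (auto simp: Let_def)
  ultimately show ?case
    unfolding list.map sum_list.Cons sum_lessThan_add by metis
qed simp

section \<open>Restriction of vectors and matrices to selected coordinates\<close>

definition select :: "nat set \<Rightarrow> 'a vec \<Rightarrow> 'a vec" where
  "select K v = vec_of_list (nths (list_of_vec v) K)"

lemma dim_select [simp]: "dim_vec (select K v) = card {i. i < dim_vec v \<and> i \<in> K}"
  by (simp add: select_def length_nths)

lemma index_select: "i < card {i. i < dim_vec v \<and> i \<in> K} \<Longrightarrow> select K v $ i = v $ pick K i"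
  using pick_le[of i "dim_vec v" K]
  by (simp add: select_def vec_of_list_index nth_nths list_of_vec_index)

lemma select_UNIV [simp]: "select UNIV v = v"
  by (simp add: select_def nths_all vec_list)

lemma select_eqD:
  assumes "select K v = select K w" "dim_vec v = dim_vec w" "i \<in> K" "i < dim_vec v"
  shows "v $ i = w $ i"
proof -
  \<comment> \<open>The position of \<open>i\<close> in the increasing enumeration of
    \<open>K\<close>.\<close>
  let ?a = "card {a \<in> K. a < i}"
  have "{a \<in> K. a < i} \<subset> {i. i < dim_vec v \<and> i \<in> K}" using assms by auto
  then have a: "?a < card {i. i < dim_vec v \<and> i \<in> K}" by (rule psubset_card_mono[rotated]) simp
  have "select K v $ ?a = v $ i"
    by (simp only: index_select[OF a] pick_card_in_set[OF assms(3)])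
  moreover have "select K w $ ?a = w $ i"
    by (simp only: index_select[OF a[unfolded assms(2)]] pick_card_in_set[OF assms(3)])
  ultimately show ?thesis using assms(1) by simp
qed

lemma bij_betw_pick:
  "bij_betw (pick J) {..<card {j. j < m \<and> j \<in> J}} {j. j < m \<and> j \<in> J}"
proof -
  let ?J = "{j. j < m \<and> j \<in> J}"
  \<comment> \<open>\<open>J\<close> may be infinite, for instance \<open>UNIV\<close>, so
    \<open>pick\<close> is first reduced to the enumeration of the finite trace
    \<open>?J\<close>.\<close>
  have eq: "pick J i = pick ?J i" if "i < card ?J" for i using pick_reduce_set[OF that] .
  have inj: "inj_on (pick J) {..<card ?J}"
  proof (rule inj_onI)
    fix a b assume "a \<in> {..<card ?J}" "b \<in> {..<card ?J}" "pick J a = pick J b"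
    then show "a = b"
      using eq pick_mono_le[of a ?J b] pick_mono_le[of b ?J a] by (cases a b rule: linorder_cases) auto
  qed
  moreover have "pick J ` {..<card ?J} = ?J"
  proof (rule card_subset_eq)
    show "pick J ` {..<card ?J} \<subseteq> ?J" using eq pick_in_set_le[of _ ?J] by auto
    show "card (pick J ` {..<card ?J}) = card ?J" by (simp add: card_image[OF inj])
  qed simp
  ultimately show ?thesis by (simp add: bij_betw_def)
qed

text \<open>Deleted columns only meet zeros of \<open>v\<close>, and deleting rows restricts the
  result; \<open>submatrix\<close> and \<open>select\<close> enumerate the surviving indices in the
  same order. Thus a truncated matrix acts on a reduced state as the full matrix acts on the
  zero-padded one.\<close>

lemma submatrix_mult_select:
  fixes M :: "real mat"
  assumes M: "M \<in> carrier_mat n m" and v: "v \<in> carrier_vec m"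
    and zero: "\<And>j. j < m \<Longrightarrow> j \<notin> J \<Longrightarrow> v $ j = 0"
  shows "submatrix M I J *\<^sub>v select J v = select I (M *\<^sub>v v)"
proof
  show "dim_vec (submatrix M I J *\<^sub>v select J v) = dim_vec (select I (M *\<^sub>v v))"
    by (simp add: dim_submatrix)
  fix i assume "i < dim_vec (select I (M *\<^sub>v v))"
  then have i: "i < card {i. i < n \<and> i \<in> I}" using M by simp
  let ?J = "{j. j < m \<and> j \<in> J}"
  have pi: "pick I i < n" using pick_le[OF i] .
  have "(submatrix M I J *\<^sub>v select J v) $ i = (\<Sum>b<card ?J. M $$ (pick I i, pick J b) * v $ pick J b)"
    using M v i by (auto simp: dim_submatrix scalar_prod_def submatrix_index index_select lessThan_atLeast0
        intro!: sum.cong)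
  also have "\<dots> = (\<Sum>j\<in>?J. M $$ (pick I i, j) * v $ j)"
    by (rule sum.reindex_bij_betw[OF bij_betw_pick])
  also have "\<dots> = (\<Sum>j<m. M $$ (pick I i, j) * v $ j)"
    by (rule sum.mono_neutral_left) (auto simp: zero)
  also have "\<dots> = (M *\<^sub>v v) $ pick I i"
    using M v pi by (simp add: scalar_prod_def lessThan_atLeast0)
  also have "\<dots> = select I (M *\<^sub>v v) $ i" using M i by (simp add: index_select)
  finally show "(submatrix M I J *\<^sub>v select J v) $ i = select I (M *\<^sub>v v) $ i" .
qed

lemma nths_cong: "(\<And>i. i < length xs \<Longrightarrow> i \<in> A \<longleftrightarrow> i \<in> B) \<Longrightarrow> nths xs A = nths xs B"
  unfolding nths_def by (intro arg_cong[where f = "map fst"] filter_cong) (auto simp: in_set_zip)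

lemma select_kept_concat_vec:
  fixes v :: "'b \<Rightarrow> real vec"
  assumes "\<And>b. b \<in> set bs \<Longrightarrow> v b \<in> carrier_vec (d b)" "\<And>b. b \<in> set bs \<Longrightarrow> r b \<le> d b"
  shows "select (kept (map d bs) (map r bs)) (concat_vec (map v bs)) = concat_vec (map (\<lambda>b. vec_first (v b) (r b)) bs)"
proof -
  have "nths (list_of_vec (concat_vec (map v bs))) (kept (map d bs) (map r bs))
      = list_of_vec (concat_vec (map (\<lambda>b. vec_first (v b) (r b)) bs))"
    using assms
  proof (induction bs)
    case Nil
    then show ?case by (simp add: nths_all)
  next
    case (Cons b bs)
    let ?K = "kept (map d bs) (map r bs)"
    have vb: "dim_vec (v b) = d b" and rb: "r b \<le> d b" using Cons.prems by auto
    \<comment> \<open>The shifted positions lie at or beyond \<open>d b\<close>, outside the first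
      block.\<close>
    have "nths (list_of_vec (v b)) ({..<r b} \<union> (\<lambda>i. d b + i) ` ?K) = nths (list_of_vec (v b)) {..<r b}"
      using vb by (intro nths_cong) auto
    also have "\<dots> = list_of_vec (vec_first (v b) (r b))"
      using vb rb by (intro nth_equalityI) (auto simp: list_of_vec_index vec_first_def)
    finally have 1: "nths (list_of_vec (v b)) ({..<r b} \<union> (\<lambda>i. d b + i) ` ?K) = list_of_vec (vec_first (v b) (r b))" .
    have 2: "{j. j + d b \<in> {..<r b} \<union> (\<lambda>i. d b + i) ` ?K} = ?K" using rb by (auto simp: image_iff)
    show ?case
      using Cons by (simp add: nths_append vb 1 2 del: Un_iff)
  qed
  then show ?thesis unfolding select_def by (simp add: vec_list)
qed

section \<open>Truncation without change of dimension\<close>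

text \<open>Masking rows is enough: initial states are zero and masked successors are zero, so the
  corresponding columns of A and C only ever multiply zeros.\<close>

definition mask_rows :: "nat set \<Rightarrow> real mat \<Rightarrow> real mat" where
  "mask_rows K M = mat (dim_row M) (dim_col M) (\<lambda>(i,j). if i \<in> K then M $$ (i,j) else 0)"

lemma dim_mask_rows [simp]: "dim_row (mask_rows K M) = dim_row M" "dim_col (mask_rows K M) = dim_col M"
  by (simp_all add: mask_rows_def)

lemma mask_rows_carrier [simp]: "mask_rows K M \<in> carrier_mat n m \<longleftrightarrow> M \<in> carrier_mat n m"
  by (metis carrier_matD carrier_matI dim_mask_rows)

lemma index_mask_rows_mult:
  assumes "i < dim_row M" "dim_vec v = dim_col M"
  shows "(mask_rows K M *\<^sub>v v) $ i = (if i \<in> K then (M *\<^sub>v v) $ i else 0)"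
  using assms by (auto simp: mask_rows_def scalar_prod_def)

lemma uniformly_bounded_mask_rows:
  assumes "uniformly_bounded M"
  shows "uniformly_bounded (\<lambda>t. mask_rows (K t) (M t))"
proof -
  from assms obtain c where c: "\<And>t v. v \<in> carrier_vec (dim_col (M t)) \<Longrightarrow> vec_norm2 (M t *\<^sub>v v) \<le> c * vec_norm2 v"
    by (auto simp: uniformly_bounded_def)
  have "vec_norm2 (mask_rows (K t) (M t) *\<^sub>v v) \<le> vec_norm2 (M t *\<^sub>v v)"
    if "v \<in> carrier_vec (dim_col (M t))" for t v
    unfolding vec_norm2_def scalar_prod_self using that
    by (auto simp: index_mask_rows_mult intro!: sum_mono simp del: index_mult_mat_vec)
  with c show ?thesis unfolding uniformly_bounded_def
    by (metis (no_types, lifting) dim_mask_rows(2) order_trans)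
qed

text \<open>The truncated system on the original state space, with the truncated states forced to be zero.\<close>

definition masked :: "(nat \<times> nat) set \<Rightarrow> dist_sys \<Rightarrow> (nat \<Rightarrow> nat \<Rightarrow> nat) \<Rightarrow> (nat \<times> nat \<Rightarrow> nat \<Rightarrow> nat) \<Rightarrow> dist_sys" where
  "masked E S r rs =
     (let rows = (\<lambda>k t. kept (out_dims E S k (t+1)) (at_out E r rs k (t+1)))
      in S\<lparr>Amat := \<lambda>k t. mask_rows (rows k t) (Amat S k t), Bmat := \<lambda>k t. mask_rows (rows k t) (Bmat S k t)\<rparr>)"

lemma masked_simps [simp]:
  "tdim (masked E S r rs) = tdim S" "sdim (masked E S r rs) = sdim S"
  "udim (masked E S r rs) = udim S" "ydim (masked E S r rs) = ydim S"
  "Amat (masked E S r rs) k t = mask_rows (kept (out_dims E S k (t+1)) (at_out E r rs k (t+1))) (Amat S k t)"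
  "Bmat (masked E S r rs) k t = mask_rows (kept (out_dims E S k (t+1)) (at_out E r rs k (t+1))) (Bmat S k t)"
  "Cmat (masked E S r rs) = Cmat S" "Dmat (masked E S r rs) = Dmat S"
  by (simp_all add: masked_def)

lemma truncation_simps [simp]:
  "tdim (truncation E S r rs) = r" "sdim (truncation E S r rs) = rs"
  "udim (truncation E S r rs) = udim S" "ydim (truncation E S r rs) = ydim S"
  "Amat (truncation E S r rs) k t = submatrix (Amat S k t)
    (kept (out_dims E S k (t+1)) (at_out E r rs k (t+1))) (kept (in_dims E S k t) (at_in E r rs k t))"
  "Bmat (truncation E S r rs) k t = submatrix (Bmat S k t)
    (kept (out_dims E S k (t+1)) (at_out E r rs k (t+1))) UNIV"
  "Cmat (truncation E S r rs) k t = submatrix (Cmat S k t) UNIV (kept (in_dims E S k t) (at_in E r rs k t))"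
  "Dmat (truncation E S r rs) = Dmat S"
  by (simp_all add: truncation_def)

section \<open>Trajectories of masked and truncated systems\<close>

context
  fixes N E S
  assumes sys: "distributed_system N E S"
begin

lemma E_subset: "E \<subseteq> nodes N \<times> nodes N"
  using sys by (simp add: distributed_system_def)

lemma finite_E: "finite E"
  using E_subset by (rule finite_subset) simp

lemma realization_carrier:
  assumes "k \<in> nodes N"
  shows "Amat S k t \<in> carrier_mat (sum_list (out_dims E S k (Suc t))) (sum_list (in_dims E S k t))"
    "Bmat S k t \<in> carrier_mat (sum_list (out_dims E S k (Suc t))) (udim S k t)"
    "Cmat S k t \<in> carrier_mat (ydim S k t) (sum_list (in_dims E S k t))"
    "Dmat S k t \<in> carrier_mat (ydim S k t) (udim S k t)"
  using sys assms by (auto simp: distributed_system_def)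

text \<open>Zeroing rows cannot increase an operator norm. The result makes
  \<open>io_map_total\<close> and \<open>io_map_unique\<close> available for the partially truncated
  systems, whose outputs are the intermediate points of the triangle inequality.\<close>

lemma distributed_system_masked: "distributed_system N E (masked E S r rs)"
proof -
  have "uniformly_bounded (Amat (masked E S r rs) k)" "uniformly_bounded (Bmat (masked E S r rs) k)"
    if "k \<in> nodes N" for k
  proof -
    have "uniformly_bounded (Amat S k)" "uniformly_bounded (Bmat S k)"
      using sys that by (simp_all add: distributed_system_def)
    from this[THEN uniformly_bounded_mask_rows]
    show "uniformly_bounded (Amat (masked E S r rs) k)" "uniformly_bounded (Bmat (masked E S r rs) k)"
      by (simp_all add: masked_def Let_def)
  qed
  then show ?thesis using sys by (simp add: distributed_system_def)
qed

lemma in_items_cases: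
  assumes "b \<in> set (in_items E k)" obtains "b = Inl k" | e where "e \<in> E" "b = Inr e"
  using assms by (auto simp: in_items_def nbrs[OF sys])

lemma out_items_cases:
  assumes "b \<in> set (out_items E k)" obtains "b = Inl k" | e where "e \<in> E" "b = Inr e"
  using assms by (auto simp: out_items_def nbrs[OF sys])

text \<open>An edge enters exactly one node, so the input lists together meet each spatial state
  once. \<open>sum_out_items\<close> is the mirror image, with the node that an edge leaves.\<close>

lemma sum_in_items:
  fixes f :: "nat + nat \<times> nat \<Rightarrow> 'a :: comm_monoid_add"
  shows "(\<Sum>k\<in>nodes N. \<Sum>b\<leftarrow>in_items E k. f b) = (\<Sum>k\<in>nodes N. f (Inl k)) + (\<Sum>e\<in>E. f (Inr e))"
proof -
  have d: "distinct (in_nbrs E k)" for k using nbrs(1)[OF sys] by (simp add: in_nbrs_def)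
  have "(\<Sum>k\<in>nodes N. \<Sum>b\<leftarrow>in_items E k. f b)
      = (\<Sum>k\<in>nodes N. f (Inl k)) + (\<Sum>k\<in>nodes N. \<Sum>i\<in>{i. (i,k) \<in> E}. f (Inr (i,k)))"
    using d by (simp add: in_items_def sum.distrib o_def sum_list_distinct_conv_sum_set nbrs[OF sys])
  also have "(\<Sum>k\<in>nodes N. \<Sum>i\<in>{i. (i,k) \<in> E}. f (Inr (i,k)))
      = (\<Sum>(k,i)\<in>Sigma (nodes N) (\<lambda>k. {i. (i,k) \<in> E}). f (Inr (i,k)))"
    using nbrs(1)[OF sys] by (subst sum.Sigma) auto
  also have "\<dots> = (\<Sum>e\<in>E. f (Inr e))"
    using E_subset by (intro sum.reindex_bij_witness[of _ prod.swap prod.swap]) auto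
  finally show ?thesis .
qed

lemma sum_out_items:
  fixes f :: "nat + nat \<times> nat \<Rightarrow> 'a :: comm_monoid_add"
  shows "(\<Sum>k\<in>nodes N. \<Sum>b\<leftarrow>out_items E k. f b) = (\<Sum>k\<in>nodes N. f (Inl k)) + (\<Sum>e\<in>E. f (Inr e))"
proof -
  have "(\<Sum>k\<in>nodes N. \<Sum>b\<leftarrow>out_items E k. f b)
      = (\<Sum>k\<in>nodes N. f (Inl k)) + (\<Sum>k\<in>nodes N. \<Sum>j\<in>{j. (k,j) \<in> E}. f (Inr (k,j)))"
    using nbrs(5)[OF sys]
    by (simp add: out_items_def sum.distrib o_def sum_list_distinct_conv_sum_set nbrs[OF sys])
  also have "(\<Sum>k\<in>nodes N. \<Sum>j\<in>{j. (k,j) \<in> E}. f (Inr (k,j)))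
      = (\<Sum>(k,j)\<in>Sigma (nodes N) (\<lambda>k. {j. (k,j) \<in> E}). f (Inr (k,j)))"
    using nbrs(2)[OF sys] by (subst sum.Sigma) auto
  also have "\<dots> = (\<Sum>e\<in>E. f (Inr e))"
    using E_subset by (intro sum.cong) auto
  finally show ?thesis .
qed

lemma trajectory_item_carrier:
  assumes "is_signal N d x" "\<forall>e\<in>E. \<forall>t. xs e t \<in> carrier_vec (ds e t)" "k \<in> nodes N"
    "b \<in> set (in_items E k) \<union> set (out_items E k)"
  shows "item x xs t b \<in> carrier_vec (item d ds t b)"
  using assms by (auto simp: is_signal_def elim!: in_items_cases out_items_cases)

lemma dim_item_le:
  assumes "\<And>k t. k \<in> nodes N \<Longrightarrow> r k t \<le> tdim S k t" "\<And>e t. e \<in> E \<Longrightarrow> rs e t \<le> sdim S e t" "k \<in> nodes N"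
    "b \<in> set (in_items E k) \<union> set (out_items E k)"
  shows "item r rs t b \<le> item (tdim S) (sdim S) t b"
  using assms by (auto elim!: in_items_cases out_items_cases)

text \<open>Applied to two nested truncations, the case split yields the three alternatives of
  \<open>truncation_energy_bound\<close>: kept in both systems, in neither, or in the larger one
  only.\<close>

lemma masked_trajectory_successor:
  assumes tr: "is_trajectory N E (masked E S r rs) u x xs y" and k: "k \<in> nodes N"
    and p: "p < sum_list (out_dims E S k (Suc t))"
  shows "concat_vec (at_out E x xs k (Suc t)) $ p =
    (if p \<in> kept (out_dims E S k (Suc t)) (at_out E r rs k (Suc t))
     then (Amat S k t *\<^sub>v concat_vec (at_in E x xs k t) + Bmat S k t *\<^sub>v u k t) $ p else 0)"
proof -
  have "concat_vec (at_in E x xs k t) \<in> carrier_vec (sum_list (in_dims E S k t))"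
    unfolding at_in_items using tr k
    by (intro concat_vec_map_carrier trajectory_item_carrier[of "tdim S" x xs "sdim S"])
      (auto simp: is_trajectory_def)
  moreover have "u k t \<in> carrier_vec (udim S k t)" using tr k by (auto simp: is_trajectory_def is_signal_def)
  moreover have "concat_vec (at_out E x xs k (Suc t)) = Amat (masked E S r rs) k t *\<^sub>v concat_vec (at_in E x xs k t)
      + Bmat (masked E S r rs) k t *\<^sub>v u k t"
    using tr k by (simp add: is_trajectory_def del: masked_simps)
  ultimately show ?thesis
    using p realization_carrier[OF k, of t]
    by (auto simp: index_mask_rows_mult simp del: index_mult_mat_vec)
qed

text \<open>Padding the reduced states with zeros turns a trajectory of the truncation into a masked
  one with the same input and output.\<close>

lemma io_map_truncation_masked:
  assumes r: "\<And>k t. k \<in> nodes N \<Longrightarrow> r k t \<le> tdim S k t" and rs: "\<And>e t. e \<in> E \<Longrightarrow> rs e t \<le> sdim S e t"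
    and io: "(u, z) \<in> io_map N E (truncation E S r rs)"
  shows "(u, z) \<in> io_map N E (masked E S r rs)"
proof -
  from io obtain x xs where tr: "is_trajectory N E (truncation E S r rs) u x xs z" by (auto simp: io_map_def)
  define X where "X k t = vec (tdim S k t) (\<lambda>i. if i < r k t then x k t $ i else 0)" for k t
  define Xs where "Xs e t = vec (sdim S e t) (\<lambda>i. if i < rs e t then xs e t $ i else 0)" for e t
  have X: "is_signal N (tdim S) X" "\<forall>e\<in>E. \<forall>t. Xs e t \<in> carrier_vec (sdim S e t)"
    by (auto simp: is_signal_def X_def Xs_def)
  have x: "is_signal N r x" "\<forall>e\<in>E. \<forall>t. xs e t \<in> carrier_vec (rs e t)"
    using tr by (auto simp: is_trajectory_def)
  have first: "vec_first (item X Xs t b) (item r rs t b) = item x xs t b"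
    if "k \<in> nodes N" "b \<in> set (in_items E k) \<union> set (out_items E k)" for k t b
    using trajectory_item_carrier[OF x that, of t] dim_item_le[of r rs, OF r rs that, of t]
    by (intro eq_vecI) (auto simp: vec_first_def X_def Xs_def split: sum.splits)
  have zero: "item X Xs t b $ i = 0" if "i < item (tdim S) (sdim S) t b" "\<not> i < item r rs t b" for t b i
    using that by (auto simp: X_def Xs_def split: sum.splits)
  have sel: "select (kept (map (item (tdim S) (sdim S) t) bs) (map (item r rs t) bs)) (concat_vec (map (item X Xs t) bs))
      = concat_vec (map (item x xs t) bs)"
    and out: "p < sum_list (map (item (tdim S) (sdim S) t) bs) \<Longrightarrow>
      p \<notin> kept (map (item (tdim S) (sdim S) t) bs) (map (item r rs t) bs) \<Longrightarrow>
      concat_vec (map (item X Xs t) bs) $ p = 0"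
    if k: "k \<in> nodes N" and bs: "bs = in_items E k \<or> bs = out_items E k" for k t bs p
  proof -
    have car: "\<forall>b\<in>set bs. item X Xs t b \<in> carrier_vec (item (tdim S) (sdim S) t b)"
      using trajectory_item_carrier[OF X k] bs by auto
    have le: "\<forall>b\<in>set bs. item r rs t b \<le> item (tdim S) (sdim S) t b"
      using dim_item_le[of r rs, OF r rs k] bs by auto
    show "select (kept (map (item (tdim S) (sdim S) t) bs) (map (item r rs t) bs)) (concat_vec (map (item X Xs t) bs))
        = concat_vec (map (item x xs t) bs)"
      using car le first[OF k] bs
      by (subst select_kept_concat_vec) (auto intro!: arg_cong[where f = concat_vec])
    assume "p < sum_list (map (item (tdim S) (sdim S) t) bs)"
      "p \<notin> kept (map (item (tdim S) (sdim S) t) bs) (map (item r rs t) bs)"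
    then show "concat_vec (map (item X Xs t) bs) $ p = 0"
      using locate_position[of p "item (tdim S) (sdim S) t" bs] car le zero[of _ t]
      by (metis (no_types, lifting))
  qed
  have "is_trajectory N E (masked E S r rs) u X Xs z"
    unfolding is_trajectory_def
  proof (intro conjI ballI allI)
    fix k t assume k: "k \<in> nodes N"
    let ?K = "kept (out_dims E S k (Suc t)) (at_out E r rs k (Suc t))"
    let ?J = "kept (in_dims E S k t) (at_in E r rs k t)"
    define xi where "xi = concat_vec (at_in E X Xs k t)"
    define xo where "xo = concat_vec (at_out E X Xs k (Suc t))"
    have xi: "xi \<in> carrier_vec (sum_list (in_dims E S k t))"
      unfolding xi_def at_in_items using trajectory_item_carrier[OF X k] by (intro concat_vec_map_carrier) auto
    have xo: "xo \<in> carrier_vec (sum_list (out_dims E S k (Suc t)))"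
      unfolding xo_def at_out_items using trajectory_item_carrier[OF X k] by (intro concat_vec_map_carrier) auto
    have u: "u k t \<in> carrier_vec (udim S k t)" using tr k by (auto simp: is_trajectory_def is_signal_def)
    note mats = realization_carrier[OF k, of t]
    have sel_in: "concat_vec (at_in E x xs k t) = select ?J xi"
      unfolding xi_def at_in_items using sel[OF k] by simp
    have sel_out: "concat_vec (at_out E x xs k (Suc t)) = select ?K xo"
      unfolding xo_def at_out_items using sel[OF k] by simp
    have zi: "xi $ p = 0" if "p < sum_list (in_dims E S k t)" "p \<notin> ?J" for p
      using that out[OF k, of "in_items E k" p t] unfolding xi_def at_in_items by simp
    have zo: "xo $ p = 0" if "p < sum_list (out_dims E S k (Suc t))" "p \<notin> ?K" for p
      using that out[OF k, of "out_items E k" p "Suc t"] unfolding xo_def at_out_items by simp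
    define s where "s = Amat S k t *\<^sub>v xi + Bmat S k t *\<^sub>v u k t"
    have A: "submatrix (Amat S k t) ?K ?J *\<^sub>v select ?J xi = select ?K (Amat S k t *\<^sub>v xi)"
      using zi by (intro submatrix_mult_select[OF mats(1) xi])
    have B: "submatrix (Bmat S k t) ?K UNIV *\<^sub>v u k t = select ?K (Bmat S k t *\<^sub>v u k t)"
      using submatrix_mult_select[OF mats(2) u, of UNIV ?K] by simp
    have C: "submatrix (Cmat S k t) UNIV ?J *\<^sub>v select ?J xi = Cmat S k t *\<^sub>v xi"
      using submatrix_mult_select[OF mats(3) xi, of ?J UNIV] zi by simp
    have "select ?K xo = select ?K (Amat S k t *\<^sub>v xi) + select ?K (Bmat S k t *\<^sub>v u k t)"
      using tr k by (simp add: is_trajectory_def sel_in[symmetric] sel_out[symmetric] A[symmetric] B[symmetric])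
    also have "\<dots> = select ?K s"
    proof (rule eq_vecI)
      fix i assume "i < dim_vec (select ?K s)"
      then have i: "i < card {i. i < sum_list (out_dims E S k (Suc t)) \<and> i \<in> ?K}"
        using mats by (simp add: s_def)
      show "(select ?K (Amat S k t *\<^sub>v xi) + select ?K (Bmat S k t *\<^sub>v u k t)) $ i = select ?K s $ i"
        using i pick_le[OF i] mats by (simp add: index_select s_def del: index_mult_mat_vec)
    qed (use mats in \<open>simp add: s_def\<close>)
    finally have eq: "select ?K xo = select ?K s" .
    \<comment> \<open>Rows in \<open>?K\<close> are recovered from the equality of selections, the
      others vanish by padding; together they are the masked update.\<close>
    have step: "xo $ p = (if p \<in> ?K then s $ p else 0)" if "p < sum_list (out_dims E S k (Suc t))" for p
      using select_eqD[OF eq, of p] zo[OF that] that xo mats by (auto simp: s_def)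
    show "concat_vec (at_out E X Xs k (t + 1)) =
        Amat (masked E S r rs) k t *\<^sub>v concat_vec (at_in E X Xs k t) + Bmat (masked E S r rs) k t *\<^sub>v u k t"
      using xo mats xi u step
      by (intro eq_vecI) (auto simp: xo_def[symmetric] xi_def[symmetric] index_mask_rows_mult s_def
          simp del: index_mult_mat_vec)
    show "z k t = Cmat (masked E S r rs) k t *\<^sub>v concat_vec (at_in E X Xs k t) + Dmat (masked E S r rs) k t *\<^sub>v u k t"
      using tr k C by (simp add: is_trajectory_def sel_in xi_def[symmetric])
  next
    fix k assume "k \<in> nodes N"
    then show "X k 0 = 0\<^sub>v (tdim (masked E S r rs) k 0)"
      using tr by (intro eq_vecI) (auto simp: X_def is_trajectory_def)
  next
    fix e assume "e \<in> E"
    then show "Xs e 0 = 0\<^sub>v (sdim (masked E S r rs) e 0)"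
      using tr by (intro eq_vecI) (auto simp: Xs_def is_trajectory_def)
  next
    show "is_signal N (udim (masked E S r rs)) u" "is_signal N (ydim (masked E S r rs)) z"
      using tr by (simp_all add: is_trajectory_def)
    show "is_signal N (tdim (masked E S r rs)) X" using X by simp
    show "Xs e t \<in> carrier_vec (sdim (masked E S r rs) e t)" if "e \<in> E" for e t using X that by simp
  qed
  then show ?thesis by (auto simp: io_map_def)
qed

text \<open>Start of the induction over blocks: with full orders no row is masked. The orders are
  prescribed on the graph only, so their values elsewhere stay free.\<close>

lemma is_trajectory_unmasked:
  assumes tr: "is_trajectory N E S u x xs y"
    and r: "\<And>k t. k \<in> nodes N \<Longrightarrow> r k t = tdim S k t" and rs: "\<And>e t. e \<in> E \<Longrightarrow> rs e t = sdim S e t"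
  shows "is_trajectory N E (masked E S r rs) u x xs y"
  unfolding is_trajectory_def
proof (intro conjI ballI allI)
  fix k t assume k: "k \<in> nodes N"
  have u: "u k t \<in> carrier_vec (udim S k t)" using tr k by (auto simp: is_trajectory_def is_signal_def)
  have xi: "concat_vec (at_in E x xs k t) \<in> carrier_vec (sum_list (in_dims E S k t))"
    unfolding at_in_items using tr k
    by (intro concat_vec_map_carrier trajectory_item_carrier[of "tdim S" x xs "sdim S"])
      (auto simp: is_trajectory_def)
  have kept: "p \<in> kept (out_dims E S k (Suc t)) (at_out E r rs k (Suc t))"
    if p: "p < sum_list (out_dims E S k (Suc t))" for p
  proof -
    have eq: "item r rs (Suc t) b = item (tdim S) (sdim S) (Suc t) b" if "b \<in> set (out_items E k)" for b
      using that r rs k by (auto elim!: out_items_cases)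
    obtain b i where b: "b \<in> set (out_items E k)" "i < item (tdim S) (sdim S) (Suc t) b"
      and kept: "\<And>r. (\<forall>b\<in>set (out_items E k). r b \<le> item (tdim S) (sdim S) (Suc t) b) \<Longrightarrow>
        (p \<in> kept (map (item (tdim S) (sdim S) (Suc t)) (out_items E k)) (map r (out_items E k)) \<longleftrightarrow> i < r b)"
      using locate_position[OF p[unfolded at_out_items]] by blast
    show ?thesis
      unfolding at_out_items using kept[of "item r rs (Suc t)"] b eq by simp
  qed
  show "concat_vec (at_out E x xs k (t + 1)) = Amat (masked E S r rs) k t *\<^sub>v concat_vec (at_in E x xs k t)
      + Bmat (masked E S r rs) k t *\<^sub>v u k t"
    using tr k u xi kept realization_carrier[OF k, of t]
    by (intro eq_vecI) (auto simp: is_trajectory_def index_mask_rows_mult simp del: index_mult_mat_vec)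
next
  fix k t assume "k \<in> nodes N"
  then show "y k t = Cmat (masked E S r rs) k t *\<^sub>v concat_vec (at_in E x xs k t)
      + Dmat (masked E S r rs) k t *\<^sub>v u k t"
    using tr by (simp add: is_trajectory_def)
qed (use tr in \<open>simp_all add: is_trajectory_def\<close>)

end

section \<open>Truncating one node or edge at a time\<close>

text \<open>Testing the operator bound on unit vectors gives one constant for all times, whatever
  the dimensions.\<close>

lemma uniformly_bounded_diag_entry:
  assumes "uniformly_bounded M"
  obtains c where "\<And>t i. M t \<in> carrier_mat (d t) (d t) \<Longrightarrow> i < d t \<Longrightarrow> M t $$ (i,i) \<le> c"
proof -
  from assms obtain c where c: "\<And>t v. v \<in> carrier_vec (dim_col (M t)) \<Longrightarrow> vec_norm2 (M t *\<^sub>v v) \<le> c * vec_norm2 v"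
    by (auto simp: uniformly_bounded_def)
  show thesis
  proof (rule that)
    fix t i assume M: "M t \<in> carrier_mat (d t) (d t)" and i: "i < d t"
    let ?e = "unit_vec (d t) i :: real vec"
    have ent: "(M t *\<^sub>v ?e) $ i = M t $$ (i,i)" using M i by simp
    have "(M t $$ (i,i))^2 \<le> (M t *\<^sub>v ?e) \<bullet> (M t *\<^sub>v ?e)"
      unfolding scalar_prod_self ent[symmetric]
      using M i by (intro member_le_sum) auto
    then have "M t $$ (i,i) \<le> vec_norm2 (M t *\<^sub>v ?e)"
      unfolding vec_norm2_def by (rule real_le_rsqrt)
    also have "\<dots> \<le> c * vec_norm2 ?e" using M by (intro c) auto
    also have "vec_norm2 ?e = 1" using i by (simp add: vec_norm2_def)
    finally show "M t $$ (i,i) \<le> c" by simp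
  qed
qed

lemma loewner_less_diag_entry:
  assumes "b \<cdot>\<^sub>m 1\<^sub>m n \<prec>\<^sub>L M" "M \<in> carrier_mat n n" "i < n"
  shows "b < M $$ (i,i)"
proof -
  let ?e = "unit_vec n i :: real vec"
  have "?e \<noteq> 0\<^sub>v n" using assms(3) by (metis index_unit_vec(2) index_zero_vec(1) zero_neq_one)
  then have "0 < ?e \<bullet> ((M - b \<cdot>\<^sub>m 1\<^sub>m n) *\<^sub>v ?e)"
    using assms by (auto simp: loewner_less_def pos_def_def)
  also have "\<dots> = ((M - b \<cdot>\<^sub>m 1\<^sub>m n) *\<^sub>v ?e) $ i"
    using assms(2,3) by (intro scalar_prod_left_unit mult_mat_vec_carrier[of _ n n] minus_carrier_mat) auto
  also have "\<dots> = M $$ (i,i) - b" using assms(2,3) by simp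
  finally show ?thesis by simp
qed

text \<open>Minkowski's inequality over the flattened index set of times, nodes and components. On a
  finite horizon all sums are finite, so square summability of intermediate outputs does not enter
  the induction.\<close>

lemma finite_horizon_triangle:
  fixes x y z :: signal
  assumes "is_signal N d x" "is_signal N d y" "is_signal N d z"
    and "(\<Sum>t<n. \<Sum>k\<in>nodes N. (x k t - y k t) \<bullet> (x k t - y k t)) \<le> a^2"
    and "(\<Sum>t<n. \<Sum>k\<in>nodes N. (y k t - z k t) \<bullet> (y k t - z k t)) \<le> b^2" and "0 \<le> a" "0 \<le> b"
  shows "(\<Sum>t<n. \<Sum>k\<in>nodes N. (x k t - z k t) \<bullet> (x k t - z k t)) \<le> (a + b)^2"
proof -
  define J where "J = (SIGMA t:{..<n}. SIGMA k:nodes N. {..<d k t})"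
  define D where "D x y = (\<lambda>(t,k,i). x k t $ i - y k t $ i)" for x y :: signal
  have eq: "(\<Sum>t<n. \<Sum>k\<in>nodes N. (x k t - y k t) \<bullet> (x k t - y k t)) = (L2_set (D x y) J)^2"
    if "is_signal N d x" "is_signal N d y" for x y
  proof -
    have "(\<Sum>t<n. \<Sum>k\<in>nodes N. (x k t - y k t) \<bullet> (x k t - y k t))
        = (\<Sum>t<n. \<Sum>k\<in>nodes N. \<Sum>i<d k t. (D x y (t,k,i))^2)"
    proof (intro sum.cong refl)
      fix t k assume "k \<in> nodes N"
      then have "dim_vec (x k t) = d k t" "dim_vec (y k t) = d k t"
        using that by (auto simp: is_signal_def)
      then show "(x k t - y k t) \<bullet> (x k t - y k t) = (\<Sum>i<d k t. (D x y (t,k,i))^2)"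
        by (simp add: scalar_prod_self D_def)
    qed
    also have "\<dots> = (\<Sum>j\<in>J. (D x y j)^2)"
      unfolding J_def by (simp add: sum.Sigma)
    also have "\<dots> = (L2_set (D x y) J)^2" by (simp add: L2_set_def sum_nonneg)
    finally show ?thesis .
  qed
  have "L2_set (D x z) J = L2_set (\<lambda>j. D x y j + D y z j) J"
    by (rule arg_cong2[where f = L2_set]) (auto simp: D_def)
  also have "\<dots> \<le> L2_set (D x y) J + L2_set (D y z) J" by (rule L2_set_triangle_ineq)
  also have "\<dots> \<le> a + b"
    using assms(4-7) unfolding eq[OF assms(1,2)] eq[OF assms(2,3)]
    by (intro add_mono) (auto intro: power2_le_imp_le)
  finally have "(L2_set (D x z) J)^2 \<le> (a + b)^2" by (rule power_mono) (rule L2_set_nonneg)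
  then show ?thesis unfolding eq[OF assms(1,3)] .
qed

text \<open>\<open>\<rho> < 1\<close> quantifies the strictness of the controllability inequality.\<close>

locale balanced_bounds =
  fixes N E S \<Sigma> \<Sigma>s and \<rho> M :: real
  assumes sys: "distributed_system N E S"
    and \<Sigma>: "\<And>k t. k \<in> nodes N \<Longrightarrow> \<Sigma> k t \<in> carrier_mat (tdim S k t) (tdim S k t)"
      "\<And>k t i. k \<in> nodes N \<Longrightarrow> i < tdim S k t \<Longrightarrow> 0 < \<Sigma> k t $$ (i,i)"
      "\<And>k t i. k \<in> nodes N \<Longrightarrow> i < tdim S k t \<Longrightarrow> \<Sigma> k t $$ (i,i) \<le> M"
    and \<Sigma>s: "\<And>e t. e \<in> E \<Longrightarrow> \<Sigma>s e t \<in> carrier_mat (sdim S e t) (sdim S e t)"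
      "\<And>e t i. e \<in> E \<Longrightarrow> i < sdim S e t \<Longrightarrow> 0 < \<Sigma>s e t $$ (i,i)"
      "\<And>e t i. e \<in> E \<Longrightarrow> i < sdim S e t \<Longrightarrow> \<Sigma>s e t $$ (i,i) \<le> M"
    and \<rho>: "0 \<le> \<rho>" "\<rho> < 1"
    and obs: "\<And>k t v. k \<in> nodes N \<Longrightarrow> v \<in> carrier_vec (sum_list (in_dims E S k t)) \<Longrightarrow>
      (\<Sum>p<sum_list (out_dims E S k (Suc t)). diag_block_mat (at_out E \<Sigma> \<Sigma>s k (Suc t)) $$ (p,p) * ((Amat S k t *\<^sub>v v) $ p)^2)
        + (Cmat S k t *\<^sub>v v) \<bullet> (Cmat S k t *\<^sub>v v)
      \<le> (\<Sum>p<sum_list (in_dims E S k t). diag_block_mat (at_in E \<Sigma> \<Sigma>s k t) $$ (p,p) * (v $ p)^2)"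
    and con: "\<And>k t v u. k \<in> nodes N \<Longrightarrow> v \<in> carrier_vec (sum_list (in_dims E S k t)) \<Longrightarrow> u \<in> carrier_vec (udim S k t) \<Longrightarrow>
      (\<Sum>p<sum_list (out_dims E S k (Suc t)). ((Amat S k t *\<^sub>v v + Bmat S k t *\<^sub>v u) $ p)^2
          / diag_block_mat (at_out E \<Sigma> \<Sigma>s k (Suc t)) $$ (p,p))
      \<le> \<rho> * ((\<Sum>p<sum_list (in_dims E S k t). (v $ p)^2 / diag_block_mat (at_in E \<Sigma> \<Sigma>s k t) $$ (p,p)) + u \<bullet> u)"
begin

lemma gramian_item_carrier:
  assumes "k \<in> nodes N" "b \<in> set (in_items E k) \<union> set (out_items E k)"
  shows "item \<Sigma> \<Sigma>s t b \<in> carrier_mat (item (tdim S) (sdim S) t b) (item (tdim S) (sdim S) t b)"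
  using assms \<Sigma> \<Sigma>s by (auto elim!: in_items_cases[OF sys] out_items_cases[OF sys])

text \<open>Each temporal state occurs in the lists of its own node, each spatial state in one
  output list and one input list, so both totals run over the same blocks. Local inequalities lead
  from input lists at time t to output lists at t + 1; this identity closes the loop and lets their
  sum over the nodes be iterated.\<close>

lemma sum_out_eq_sum_in:
  fixes \<phi> :: "real \<Rightarrow> real \<Rightarrow> real \<Rightarrow> real"
  assumes x: "is_signal N (tdim S) x" "\<forall>e\<in>E. \<forall>t. xs e t \<in> carrier_vec (sdim S e t)"
    and x': "is_signal N (tdim S) x'" "\<forall>e\<in>E. \<forall>t. xs' e t \<in> carrier_vec (sdim S e t)"
  shows "(\<Sum>k\<in>nodes N. \<Sum>p<sum_list (out_dims E S k t). \<phi> (diag_block_mat (at_out E \<Sigma> \<Sigma>s k t) $$ (p,p))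
      (concat_vec (at_out E x xs k t) $ p) (concat_vec (at_out E x' xs' k t) $ p))
    = (\<Sum>k\<in>nodes N. \<Sum>p<sum_list (in_dims E S k t). \<phi> (diag_block_mat (at_in E \<Sigma> \<Sigma>s k t) $$ (p,p))
      (concat_vec (at_in E x xs k t) $ p) (concat_vec (at_in E x' xs' k t) $ p))"
    (is "?out = ?in")
proof -
  define f where "f b = (\<Sum>i<item (tdim S) (sdim S) t b. \<phi> (item \<Sigma> \<Sigma>s t b $$ (i,i)) (item x xs t b $ i) (item x' xs' t b $ i))"
    for b
  have "?out = (\<Sum>k\<in>nodes N. \<Sum>b\<leftarrow>out_items E k. f b)"
    unfolding at_out_items f_def
  proof (rule sum.cong[OF refl], rule sum_concat_vec)
    fix k b assume "k \<in> nodes N" "b \<in> set (out_items E k)"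
    then show "item \<Sigma> \<Sigma>s t b \<in> carrier_mat (item (tdim S) (sdim S) t b) (item (tdim S) (sdim S) t b)"
      "item x xs t b \<in> carrier_vec (item (tdim S) (sdim S) t b)"
      "item x' xs' t b \<in> carrier_vec (item (tdim S) (sdim S) t b)"
      using gramian_item_carrier trajectory_item_carrier[OF sys x] trajectory_item_carrier[OF sys x'] by auto
  qed
  moreover have "?in = (\<Sum>k\<in>nodes N. \<Sum>b\<leftarrow>in_items E k. f b)"
    unfolding at_in_items f_def
  proof (rule sum.cong[OF refl], rule sum_concat_vec)
    fix k b assume "k \<in> nodes N" "b \<in> set (in_items E k)"
    then show "item \<Sigma> \<Sigma>s t b \<in> carrier_mat (item (tdim S) (sdim S) t b) (item (tdim S) (sdim S) t b)"
      "item x xs t b \<in> carrier_vec (item (tdim S) (sdim S) t b)"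
      "item x' xs' t b \<in> carrier_vec (item (tdim S) (sdim S) t b)"
      using gramian_item_carrier trajectory_item_carrier[OF sys x] trajectory_item_carrier[OF sys x'] by auto
  qed
  ultimately show ?thesis by (simp only: sum_in_items[OF sys] sum_out_items[OF sys])
qed

text \<open>The hypotheses \<open>new\<close> treat node and edge steps alike: wherever the two
  families of orders differ, the time lies in \<open>F\<close> and the gramian entry is
  \<open>w t\<close>, so a single pair of weights suffices.\<close>

lemma truncation_step_energy:
  assumes tr': "is_trajectory N E (masked E S r' rs') u x' xs' y'"
    and tr: "is_trajectory N E (masked E S r rs) u x xs y"
    and le: "\<And>k t. k \<in> nodes N \<Longrightarrow> r k t \<le> r' k t" "\<And>k t. k \<in> nodes N \<Longrightarrow> r' k t \<le> tdim S k t"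
      "\<And>e t. e \<in> E \<Longrightarrow> rs e t \<le> rs' e t" "\<And>e t. e \<in> E \<Longrightarrow> rs' e t \<le> sdim S e t"
    and new: "\<And>k t i. k \<in> nodes N \<Longrightarrow> r k t \<le> i \<Longrightarrow> i < r' k t \<Longrightarrow> t \<in> F \<and> \<Sigma> k t $$ (i,i) = w t"
      "\<And>e t i. e \<in> E \<Longrightarrow> rs e t \<le> i \<Longrightarrow> i < rs' e t \<Longrightarrow> t \<in> F \<and> \<Sigma>s e t $$ (i,i) = w t"
    and w: "mono_on F w \<or> antimono_on F w" "\<And>t. t \<in> F \<Longrightarrow> 0 < w t" "\<And>t. t \<in> F \<Longrightarrow> w t \<le> W" "0 \<le> W"
  shows "(\<Sum>t<n. \<Sum>k\<in>nodes N. (y' k t - y k t) \<bullet> (y' k t - y k t))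
    \<le> 4 * \<rho> * W^2 * (\<Sum>t<n. \<Sum>k\<in>nodes N. u k t \<bullet> u k t)"
proof -
  obtain a c where ac: "decseq a" "decseq c" "\<And>t. 1 \<le> a t" "\<And>t. 0 \<le> c t"
    "\<And>t. c t \<le> W^2" "\<And>t. t \<in> F \<Longrightarrow> c t = a t * (w t)^2"
    using monotone_weights[OF w] by blast
  define xi where "xi k t = concat_vec (at_in E x xs k t)" for k t
  define xi' where "xi' k t = concat_vec (at_in E x' xs' k t)" for k t
  define p where "p k t = Amat S k t *\<^sub>v xi k t + Bmat S k t *\<^sub>v u k t" for k t
  define p' where "p' k t = Amat S k t *\<^sub>v xi' k t + Bmat S k t *\<^sub>v u k t" for k t
  \<comment> \<open>Coordinates are indexed by positions in the output lists, where masking acts;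
    the storage at time t is moved to the input lists by \<open>sum_out_eq_sum_in\<close>.\<close>
  define \<sigma> where "\<sigma> t = (\<lambda>(k,p). diag_block_mat (at_out E \<Sigma> \<Sigma>s k t) $$ (p,p))" for t
  define z where "z t = (\<lambda>(k,p). concat_vec (at_out E x xs k t) $ p)" for t
  define z' where "z' t = (\<lambda>(k,p). concat_vec (at_out E x' xs' k t) $ p)" for t
  define I where "I t = (SIGMA k:nodes N. {..<sum_list (out_dims E S k t)})" for t
  have x: "is_signal N (tdim S) x" "\<forall>e\<in>E. \<forall>t. xs e t \<in> carrier_vec (sdim S e t)"
    and x': "is_signal N (tdim S) x'" "\<forall>e\<in>E. \<forall>t. xs' e t \<in> carrier_vec (sdim S e t)"
    using tr tr' by (simp_all add: is_trajectory_def)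
  have x0: "\<forall>k\<in>nodes N. x k 0 = 0\<^sub>v (tdim S k 0)" "\<forall>e\<in>E. xs e 0 = 0\<^sub>v (sdim S e 0)"
    and x'0: "\<forall>k\<in>nodes N. x' k 0 = 0\<^sub>v (tdim S k 0)" "\<forall>e\<in>E. xs' e 0 = 0\<^sub>v (sdim S e 0)"
    using tr tr' by (simp_all add: is_trajectory_def)
  have u: "u k t \<in> carrier_vec (udim S k t)" if "k \<in> nodes N" for k t
    using tr that by (simp add: is_trajectory_def is_signal_def)
  have y: "y k t = Cmat S k t *\<^sub>v xi k t + Dmat S k t *\<^sub>v u k t"
    "y' k t = Cmat S k t *\<^sub>v xi' k t + Dmat S k t *\<^sub>v u k t" if "k \<in> nodes N" for k t
    using tr tr' that by (simp_all add: is_trajectory_def xi_def xi'_def)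
  have xi: "xi k t \<in> carrier_vec (sum_list (in_dims E S k t))"
    "xi' k t \<in> carrier_vec (sum_list (in_dims E S k t))" if "k \<in> nodes N" for k t
    unfolding xi_def xi'_def at_in_items
    using trajectory_item_carrier[OF sys x that] trajectory_item_carrier[OF sys x' that]
    by (intro concat_vec_map_carrier; auto)+
  have loc: "\<exists>b i. (b = Inl k \<or> (\<exists>e\<in>E. b = Inr e)) \<and> i < item (tdim S) (sdim S) t b \<and>
      \<sigma> t (k,q) = item \<Sigma> \<Sigma>s t b $$ (i,i) \<and> z t (k,q) = item x xs t b $ i \<and> z' t (k,q) = item x' xs' t b $ i \<and>
      (q \<in> kept (out_dims E S k t) (at_out E r rs k t) \<longleftrightarrow> i < item r rs t b) \<and>
      (q \<in> kept (out_dims E S k t) (at_out E r' rs' k t) \<longleftrightarrow> i < item r' rs' t b)"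
    if k: "k \<in> nodes N" and q: "q < sum_list (out_dims E S k t)" for k q t
  proof -
    have *: "\<forall>b\<in>set (out_items E k). item r rs t b \<le> item (tdim S) (sdim S) t b"
      "\<forall>b\<in>set (out_items E k). item r' rs' t b \<le> item (tdim S) (sdim S) t b"
      using dim_item_le[OF sys _ _ k, of r rs] dim_item_le[OF sys _ _ k, of r' rs'] le
      by (meson UnI2 order_trans)+
    have **: "\<forall>b\<in>set (out_items E k). item x xs t b \<in> carrier_vec (item (tdim S) (sdim S) t b)"
      "\<forall>b\<in>set (out_items E k). item x' xs' t b \<in> carrier_vec (item (tdim S) (sdim S) t b)"
      "\<forall>b\<in>set (out_items E k). item \<Sigma> \<Sigma>s t b \<in> carrier_mat (item (tdim S) (sdim S) t b) (item (tdim S) (sdim S) t b)"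
      using trajectory_item_carrier[OF sys x k] trajectory_item_carrier[OF sys x' k] gramian_item_carrier[OF k]
      by blast+
    obtain b i where b: "b \<in> set (out_items E k)" "i < item (tdim S) (sdim S) t b"
      and r: "\<And>r. (\<forall>b\<in>set (out_items E k). r b \<le> item (tdim S) (sdim S) t b) \<Longrightarrow>
        (q \<in> kept (map (item (tdim S) (sdim S) t) (out_items E k)) (map r (out_items E k)) \<longleftrightarrow> i < r b)"
      and v: "\<And>v. (\<forall>b\<in>set (out_items E k). v b \<in> carrier_vec (item (tdim S) (sdim S) t b)) \<Longrightarrow>
        concat_vec (map v (out_items E k)) $ q = v b $ i"
      and M: "\<And>M :: _ \<Rightarrow> real mat. (\<forall>b\<in>set (out_items E k). M b \<in> carrier_mat (item (tdim S) (sdim S) t b) (item (tdim S) (sdim S) t b)) \<Longrightarrow>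
        diag_block_mat (map M (out_items E k)) $$ (q, q) = M b $$ (i, i)"
      using locate_position[OF q[unfolded at_out_items]] by blast
    show ?thesis
      using b(2) r[OF *(1)] r[OF *(2)] v[OF **(1)] v[OF **(2)] M[OF **(3)]
      by (intro exI[of _ b] exI[of _ i] conjI)
        (simp_all add: \<sigma>_def z_def z'_def at_out_items, use b(1) in \<open>auto elim!: out_items_cases[OF sys]\<close>)
  qed
  have I_sum: "(\<Sum>i\<in>I t. f i) = (\<Sum>k\<in>nodes N. \<Sum>q<sum_list (out_dims E S k t). f (k,q))" for t and f :: "_ \<Rightarrow> real"
    unfolding I_def by (simp add: sum.Sigma)
  show ?thesis
  proof (rule truncation_energy_bound[where z = z and z' = z' and p = "\<lambda>t (k,q). p k t $ q"
        and p' = "\<lambda>t (k,q). p' k t $ q" and \<sigma> = \<sigma> and I = I and a = a and c = c])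
    show "0 < \<sigma> t j" if "j \<in> I t" for j t
    proof -
      obtain k q where j: "j = (k,q)" "k \<in> nodes N" "q < sum_list (out_dims E S k t)"
        using \<open>j \<in> I t\<close> by (auto simp: I_def)
      from loc[OF j(2,3)] show ?thesis using \<Sigma>(2)[OF j(2)] \<Sigma>s(2) by (auto simp: j(1))
    qed
    show "z' 0 j = 0" "z 0 j = 0" if "j \<in> I 0" for j
    proof -
      obtain k q where j: "j = (k,q)" "k \<in> nodes N" "q < sum_list (out_dims E S k 0)"
        using \<open>j \<in> I 0\<close> by (auto simp: I_def)
      from loc[OF j(2,3)] show "z' 0 j = 0" "z 0 j = 0" using x0 x'0 j(2) by (auto simp: j(1))
    qed
    show "z' (Suc t) j = (\<lambda>(k,q). p' k t $ q) j \<and> z (Suc t) j = (\<lambda>(k,q). p k t $ q) j \<or>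
        z' (Suc t) j = 0 \<and> z (Suc t) j = 0 \<or>
        z' (Suc t) j = (\<lambda>(k,q). p' k t $ q) j \<and> z (Suc t) j = 0 \<and> c (Suc t) = a (Suc t) * (\<sigma> (Suc t) j)^2"
      if "j \<in> I (Suc t)" for t j
    proof -
      obtain k q where j: "j = (k,q)" "k \<in> nodes N" "q < sum_list (out_dims E S k (Suc t))"
        using \<open>j \<in> I (Suc t)\<close> by (auto simp: I_def)
      from loc[OF j(2,3)] obtain b i where b: "b = Inl k \<or> (\<exists>e\<in>E. b = Inr e)"
        and s: "\<sigma> (Suc t) (k,q) = item \<Sigma> \<Sigma>s (Suc t) b $$ (i,i)"
        and kr: "q \<in> kept (out_dims E S k (Suc t)) (at_out E r rs k (Suc t)) \<longleftrightarrow> i < item r rs (Suc t) b"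
        and kr': "q \<in> kept (out_dims E S k (Suc t)) (at_out E r' rs' k (Suc t)) \<longleftrightarrow> i < item r' rs' (Suc t) b"
        by blast
      \<comment> \<open>Excludes the fourth combination, a coordinate kept in the smaller system but
        masked in the larger one.\<close>
      have le': "item r rs (Suc t) b \<le> item r' rs' (Suc t) b" using b le j(2) by auto
      have c': "c (Suc t) = a (Suc t) * (\<sigma> (Suc t) j)^2"
        if "\<not> i < item r rs (Suc t) b" "i < item r' rs' (Suc t) b"
      proof -
        have "Suc t \<in> F \<and> item \<Sigma> \<Sigma>s (Suc t) b $$ (i,i) = w (Suc t)"
          using b that new(1)[OF j(2), of "Suc t" i] new(2)[of _ "Suc t" i] by auto
        then show ?thesis using ac(6) s by (simp add: j(1))
      qed
      have zp: "z (Suc t) j = (if i < item r rs (Suc t) b then p k t $ q else 0)"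
        using masked_trajectory_successor[OF sys tr j(2,3)] kr by (simp add: z_def j(1) p_def xi_def)
      have zp': "z' (Suc t) j = (if i < item r' rs' (Suc t) b then p' k t $ q else 0)"
        using masked_trajectory_successor[OF sys tr' j(2,3)] kr' by (simp add: z'_def j(1) p'_def xi'_def)
      show ?thesis using le' c' zp zp' by (auto simp: j(1))
    qed
    show "(\<Sum>j\<in>I (Suc t). \<sigma> (Suc t) j * ((\<lambda>(k,q). p' k t $ q) j - (\<lambda>(k,q). p k t $ q) j)^2)
        + (\<Sum>k\<in>nodes N. (y' k t - y k t) \<bullet> (y' k t - y k t)) \<le> (\<Sum>j\<in>I t. \<sigma> t j * (z' t j - z t j)^2)" for t
    proof -
      have node: "(\<Sum>q<sum_list (out_dims E S k (Suc t)). \<sigma> (Suc t) (k,q) * (p' k t $ q - p k t $ q)^2)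
            + (y' k t - y k t) \<bullet> (y' k t - y k t)
          \<le> (\<Sum>q<sum_list (in_dims E S k t). diag_block_mat (at_in E \<Sigma> \<Sigma>s k t) $$ (q,q) * (xi' k t $ q - xi k t $ q)^2)"
        if k: "k \<in> nodes N" for k
      proof -
        note mats = realization_carrier[OF sys k, of t] and v = xi[OF k, of t]
        \<comment> \<open>Input and feedthrough cancel in the difference, so the observability
          inequality applies to \<open>d\<close> without an input term.\<close>
        define d where "d = xi' k t - xi k t"
        have d: "d \<in> carrier_vec (sum_list (in_dims E S k t))" using v by (simp add: d_def)
        have Ad: "Amat S k t *\<^sub>v d = Amat S k t *\<^sub>v xi' k t - Amat S k t *\<^sub>v xi k t"
          unfolding d_def by (rule mult_minus_distrib_mat_vec[OF mats(1) v(2,1)])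
        have Cd: "Cmat S k t *\<^sub>v d = Cmat S k t *\<^sub>v xi' k t - Cmat S k t *\<^sub>v xi k t"
          unfolding d_def by (rule mult_minus_distrib_mat_vec[OF mats(3) v(2,1)])
        have 1: "y' k t - y k t = Cmat S k t *\<^sub>v d"
          using mats by (intro eq_vecI) (auto simp: y[OF k] Cd simp del: index_mult_mat_vec)
        have 2: "p' k t $ q - p k t $ q = (Amat S k t *\<^sub>v d) $ q" if "q < sum_list (out_dims E S k (Suc t))" for q
          using mats that by (simp add: p_def p'_def Ad del: index_mult_mat_vec)
        have 3: "xi' k t $ q - xi k t $ q = d $ q" if "q < sum_list (in_dims E S k t)" for q
          using that v by (simp add: d_def)
        show ?thesis using obs[OF k d] by (simp add: 1 2 3 \<sigma>_def)
      qed
      have "(\<Sum>j\<in>I (Suc t). \<sigma> (Suc t) j * ((\<lambda>(k,q). p' k t $ q) j - (\<lambda>(k,q). p k t $ q) j)^2)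
          + (\<Sum>k\<in>nodes N. (y' k t - y k t) \<bullet> (y' k t - y k t))
        \<le> (\<Sum>k\<in>nodes N. \<Sum>q<sum_list (in_dims E S k t). diag_block_mat (at_in E \<Sigma> \<Sigma>s k t) $$ (q,q) * (xi' k t $ q - xi k t $ q)^2)"
        unfolding I_sum sum.distrib[symmetric] prod.case by (rule sum_mono) (rule node)
      also have "\<dots> = (\<Sum>j\<in>I t. \<sigma> t j * (z' t j - z t j)^2)"
        unfolding I_sum \<sigma>_def z_def z'_def prod.case xi_def xi'_def
        using sum_out_eq_sum_in[OF x' x, of "\<lambda>s a b. s * (a - b)^2" t] by simp
      finally show ?thesis .
    qed
    show "(\<Sum>j\<in>I (Suc t). ((\<lambda>(k,q). p' k t $ q) j + (\<lambda>(k,q). p k t $ q) j)^2 / \<sigma> (Suc t) j)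
        \<le> \<rho> * ((\<Sum>j\<in>I t. (z' t j + z t j)^2 / \<sigma> t j) + 4 * (\<Sum>k\<in>nodes N. u k t \<bullet> u k t))" for t
    proof -
      have node: "(\<Sum>q<sum_list (out_dims E S k (Suc t)). (p' k t $ q + p k t $ q)^2 / \<sigma> (Suc t) (k,q))
          \<le> \<rho> * ((\<Sum>q<sum_list (in_dims E S k t). (xi' k t $ q + xi k t $ q)^2 / diag_block_mat (at_in E \<Sigma> \<Sigma>s k t) $$ (q,q))
            + 4 * (u k t \<bullet> u k t))"
        if k: "k \<in> nodes N" for k
      proof -
        note mats = realization_carrier[OF sys k, of t] and v = xi[OF k, of t] and uk = u[OF k, of t]
        \<comment> \<open>The sum is driven by \<open>u + u\<close>, whose energy is four times that
          of \<open>u\<close>.\<close>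
        define d where "d = xi' k t + xi k t"
        have d: "d \<in> carrier_vec (sum_list (in_dims E S k t))" using v by (simp add: d_def)
        have uu: "u k t + u k t \<in> carrier_vec (udim S k t)" using uk by simp
        have Ad: "Amat S k t *\<^sub>v d = Amat S k t *\<^sub>v xi' k t + Amat S k t *\<^sub>v xi k t"
          unfolding d_def by (rule mult_add_distrib_mat_vec[OF mats(1) v(2,1)])
        have Bu: "Bmat S k t *\<^sub>v (u k t + u k t) = Bmat S k t *\<^sub>v u k t + Bmat S k t *\<^sub>v u k t"
          by (rule mult_add_distrib_mat_vec[OF mats(2) uk uk])
        have 1: "(u k t + u k t) \<bullet> (u k t + u k t) = 4 * (u k t \<bullet> u k t)"
          by (simp add: scalar_prod_self sum_distrib_left power2_eq_square algebra_simps)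
        have 2: "p' k t $ q + p k t $ q = (Amat S k t *\<^sub>v d + Bmat S k t *\<^sub>v (u k t + u k t)) $ q"
          if "q < sum_list (out_dims E S k (Suc t))" for q
          using mats that by (simp add: p_def p'_def Ad Bu del: index_mult_mat_vec)
        have 3: "xi' k t $ q + xi k t $ q = d $ q" if "q < sum_list (in_dims E S k t)" for q
          using that v by (simp add: d_def)
        show ?thesis using con[OF k d uu] by (simp add: 1 2 3 \<sigma>_def)
      qed
      have "(\<Sum>j\<in>I (Suc t). ((\<lambda>(k,q). p' k t $ q) j + (\<lambda>(k,q). p k t $ q) j)^2 / \<sigma> (Suc t) j)
        \<le> (\<Sum>k\<in>nodes N. \<rho> * ((\<Sum>q<sum_list (in_dims E S k t). (xi' k t $ q + xi k t $ q)^2 / diag_block_mat (at_in E \<Sigma> \<Sigma>s k t) $$ (q,q))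
            + 4 * (u k t \<bullet> u k t)))"
        unfolding I_sum prod.case by (rule sum_mono) (rule node)
      also have "\<dots> = \<rho> * ((\<Sum>j\<in>I t. (z' t j + z t j)^2 / \<sigma> t j) + 4 * (\<Sum>k\<in>nodes N. u k t \<bullet> u k t))"
        unfolding I_sum \<sigma>_def z_def z'_def prod.case xi_def xi'_def
        using sum_out_eq_sum_in[OF x' x, of "\<lambda>s a b. (a + b)^2 / s" t]
        by (simp add: sum_distrib_left[symmetric] sum.distrib)
      finally show ?thesis .
    qed
  qed (use ac \<rho> in \<open>auto intro!: sum_nonneg simp: scalar_prod_self\<close>)
qed

lemma truncation_error_energy:
  assumes r: "\<And>k t. k \<in> nodes N \<Longrightarrow> r k t \<le> tdim S k t" and rs: "\<And>e t. e \<in> E \<Longrightarrow> rs e t \<le> sdim S e t"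
    and new: "\<And>k t i. k \<in> nodes N \<Longrightarrow> r k t \<le> i \<Longrightarrow> i < tdim S k t \<Longrightarrow> t \<in> F k \<and> \<Sigma> k t $$ (i,i) = w k t"
      "\<And>e t i. e \<in> E \<Longrightarrow> rs e t \<le> i \<Longrightarrow> i < sdim S e t \<Longrightarrow> t \<in> Fs e \<and> \<Sigma>s e t $$ (i,i) = ws e t"
    and w: "\<And>k. k \<in> nodes N \<Longrightarrow> mono_on (F k) (w k) \<or> antimono_on (F k) (w k)"
      "\<And>k t. k \<in> nodes N \<Longrightarrow> t \<in> F k \<Longrightarrow> 0 < w k t" "\<And>k t. k \<in> nodes N \<Longrightarrow> t \<in> F k \<Longrightarrow> w k t \<le> W k"
      "\<And>k. k \<in> nodes N \<Longrightarrow> 0 \<le> W k"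
    and ws: "\<And>e. e \<in> E \<Longrightarrow> mono_on (Fs e) (ws e) \<or> antimono_on (Fs e) (ws e)"
      "\<And>e t. e \<in> E \<Longrightarrow> t \<in> Fs e \<Longrightarrow> 0 < ws e t" "\<And>e t. e \<in> E \<Longrightarrow> t \<in> Fs e \<Longrightarrow> ws e t \<le> Ws e"
      "\<And>e. e \<in> E \<Longrightarrow> 0 \<le> Ws e"
    and y: "(u, y) \<in> io_map N E S" and z: "(u, z) \<in> io_map N E (truncation E S r rs)"
  shows "(\<Sum>t<n. \<Sum>k\<in>nodes N. (y k t - z k t) \<bullet> (y k t - z k t))
    \<le> (2 * sqrt \<rho> * ((\<Sum>k\<in>nodes N. W k) + (\<Sum>e\<in>E. Ws e)))^2 * (\<Sum>t<n. \<Sum>k\<in>nodes N. u k t \<bullet> u k t)"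
proof -
  define U where "U = sqrt (\<Sum>t<n. \<Sum>k\<in>nodes N. u k t \<bullet> u k t)"
  have U: "0 \<le> U" "U^2 = (\<Sum>t<n. \<Sum>k\<in>nodes N. u k t \<bullet> u k t)"
    by (simp_all add: U_def sum_nonneg scalar_prod_self)
  text \<open>Outside \<open>nodes N\<close> and \<open>E\<close> the orders are irrelevant; taking \<open>r\<close> and \<open>rs\<close> there makes
    \<open>red (nodes N) E\<close> equal to \<open>masked E S r rs\<close>.\<close>
  define red where "red V D = masked E S (\<lambda>k t. if k \<in> nodes N - V then tdim S k t else r k t)
    (\<lambda>e t. if e \<in> E - D then sdim S e t else rs e t)" for V D
  have su: "is_signal N (udim S) u" and sy: "is_signal N (ydim S) y"
    using y by (auto simp: io_map_def is_trajectory_def)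
  have sv: "is_signal N (ydim S) v" if "(u, v) \<in> io_map N E (red V D)" for v V D
    using that by (auto simp: io_map_def is_trajectory_def red_def)
  have ex: "\<exists>v x xs. is_trajectory N E (red V D) u x xs v" for V D
    using io_map_total[OF distributed_system_masked[OF sys], where u = u] su
    by (auto simp: red_def io_map_def)
  \<comment> \<open>Quantifying over every output \<open>v\<close> lets the hypothesis apply to
    whichever intermediate trajectory \<open>ex\<close> supplies. Factoring out the root
    \<open>U\<close> of the input energy makes the bounds additive.\<close>
  define bound where "bound V D \<longleftrightarrow> (\<forall>v. (u, v) \<in> io_map N E (red V D) \<longrightarrow>
    (\<Sum>t<n. \<Sum>k\<in>nodes N. (y k t - v k t) \<bullet> (y k t - v k t)) \<le> (2 * sqrt \<rho> * (sum W V + sum Ws D) * U)^2)" for V D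
  \<comment> \<open>Shared by the inductions over nodes and edges; \<open>c\<close> is the bound on
    the scalar sequence of the block removed last.\<close>
  have step: "bound V' D'"
    if IH: "bound V D" and sub: "V \<subseteq> nodes N" "D \<subseteq> E"
      and c: "0 \<le> c" "sum W V' + sum Ws D' = sum W V + sum Ws D + c"
      and energy: "\<And>x' xs' v' x xs v. is_trajectory N E (red V D) u x' xs' v' \<Longrightarrow> is_trajectory N E (red V' D') u x xs v \<Longrightarrow>
        (\<Sum>t<n. \<Sum>k\<in>nodes N. (v' k t - v k t) \<bullet> (v' k t - v k t)) \<le> 4 * \<rho> * c^2 * U^2" for V D V' D' c
    unfolding bound_def
  proof (intro allI impI)
    fix v assume v: "(u, v) \<in> io_map N E (red V' D')"
    then obtain x xs where tv: "is_trajectory N E (red V' D') u x xs v" by (auto simp: io_map_def)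
    obtain v' x' xs' where tv': "is_trajectory N E (red V D) u x' xs' v'" using ex by blast
    then have v': "(u, v') \<in> io_map N E (red V D)" by (auto simp: io_map_def)
    have pos: "0 \<le> sum W V + sum Ws D"
      using sub w(4) ws(4) by (intro add_nonneg_nonneg sum_nonneg) blast+
    have "(\<Sum>t<n. \<Sum>k\<in>nodes N. (v' k t - v k t) \<bullet> (v' k t - v k t)) \<le> (2 * sqrt \<rho> * c * U)^2"
      using energy[OF tv' tv] \<rho>(1) by (simp add: power_mult_distrib)
    then have "(\<Sum>t<n. \<Sum>k\<in>nodes N. (y k t - v k t) \<bullet> (y k t - v k t))
        \<le> (2 * sqrt \<rho> * (sum W V + sum Ws D) * U + 2 * sqrt \<rho> * c * U)^2"
      using IH v' pos c(1) \<rho>(1) U(1)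
      by (intro finite_horizon_triangle[OF sy sv[OF v'] sv[OF v]]) (auto simp: bound_def)
    also have "2 * sqrt \<rho> * (sum W V + sum Ws D) * U + 2 * sqrt \<rho> * c * U
        = 2 * sqrt \<rho> * (sum W V' + sum Ws D') * U"
      unfolding c(2) by (simp add: algebra_simps)
    finally show "(\<Sum>t<n. \<Sum>k\<in>nodes N. (y k t - v k t) \<bullet> (y k t - v k t))
        \<le> (2 * sqrt \<rho> * (sum W V' + sum Ws D') * U)^2" .
  qed
  \<comment> \<open>The full output \<open>y\<close> is also an output of \<open>red {} {}\<close>,
    so uniqueness makes the initial error vanish.\<close>
  have init: "bound {} {}"
    unfolding bound_def
  proof (intro allI impI)
    fix v assume v: "(u, v) \<in> io_map N E (red {} {})"
    have "(u, y) \<in> io_map N E (red {} {})"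
    proof -
      obtain x xs where "is_trajectory N E S u x xs y" using y by (auto simp: io_map_def)
      then have "is_trajectory N E (red {} {}) u x xs y"
        unfolding red_def by (rule is_trajectory_unmasked[OF sys]) auto
      then show ?thesis by (auto simp: io_map_def)
    qed
    then have "y k t = v k t" if "k \<in> nodes N" for k t
      using io_map_unique[OF distributed_system_masked[OF sys]] v that unfolding red_def by blast
    then show "(\<Sum>t<n. \<Sum>k\<in>nodes N. (y k t - v k t) \<bullet> (y k t - v k t)) \<le> (2 * sqrt \<rho> * (sum W {} + sum Ws {}) * U)^2"
      by (simp add: scalar_prod_self)
  qed
  have "bound V {}" if "V \<subseteq> nodes N" for V
    using finite_subset[OF that finite_atLeastAtMost] that
  proof (induction V rule: finite_induct)
    case (insert k V)
    then have k: "k \<in> nodes N" "k \<notin> V" and V: "V \<subseteq> nodes N" by auto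
    show ?case
    proof (rule step)
      show "bound V {}" using insert by blast
      show "sum W (insert k V) + sum Ws {} = sum W V + sum Ws {} + W k" using insert by simp
      show "(\<Sum>t<n. \<Sum>k\<in>nodes N. (v' k t - v k t) \<bullet> (v' k t - v k t)) \<le> 4 * \<rho> * (W k)^2 * U^2"
        if "is_trajectory N E (red V {}) u x' xs' v'" "is_trajectory N E (red (insert k V) {}) u x xs v" for x' xs' v' x xs v
        unfolding U(2) by (rule truncation_step_energy[OF that[unfolded red_def], where F = "F k" and w = "w k"])
          (use k r rs new(1)[OF k(1)] w[OF k(1)] in \<open>auto split: if_splits\<close>)
    qed (use V w(4)[OF k(1)] in auto)
  qed (rule init)
  then have nodes: "bound (nodes N) {}" by blast
  have "bound (nodes N) D" if "D \<subseteq> E" for D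
    using finite_subset[OF that finite_E[OF sys]] that
  proof (induction D rule: finite_induct)
    case (insert e D)
    then have e: "e \<in> E" "e \<notin> D" and D: "D \<subseteq> E" by auto
    show ?case
    proof (rule step)
      show "bound (nodes N) D" using insert by blast
      show "sum W (nodes N) + sum Ws (insert e D) = sum W (nodes N) + sum Ws D + Ws e" using insert by simp
      show "(\<Sum>t<n. \<Sum>k\<in>nodes N. (v' k t - v k t) \<bullet> (v' k t - v k t)) \<le> 4 * \<rho> * (Ws e)^2 * U^2"
        if "is_trajectory N E (red (nodes N) D) u x' xs' v'" "is_trajectory N E (red (nodes N) (insert e D)) u x xs v" for x' xs' v' x xs v
        unfolding U(2) by (rule truncation_step_energy[OF that[unfolded red_def], where F = "Fs e" and w = "ws e"])
          (use e r rs new(2)[OF e(1)] ws[OF e(1)] in \<open>auto split: if_splits\<close>)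
    qed (use D ws(4)[OF e(1)] in auto)
  qed (rule nodes)
  then have "bound (nodes N) E" by blast
  moreover have "(u, z) \<in> io_map N E (red (nodes N) E)"
    using io_map_truncation_masked[OF sys r rs z] by (simp add: red_def)
  ultimately show ?thesis by (simp add: bound_def power_mult_distrib U(2))
qed

end

section \<open>The norm of the error system\<close>

text \<open>Bounded partial sums of nonnegative terms also give summability of the energy of
  \<open>e\<close>, without which \<open>l2_norm\<close> would be infinite by definition.\<close>

lemma l2_norm_le_scaled:
  assumes "\<And>n. (\<Sum>t<n. \<Sum>k\<in>nodes N. e k t \<bullet> e k t) \<le> c^2 * (\<Sum>t<n. \<Sum>k\<in>nodes N. u k t \<bullet> u k t)"
    and c: "0 \<le> c" and u: "l2_norm N u < \<infinity>"
  shows "l2_norm N e \<le> ennreal c * l2_norm N u"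
proof -
  let ?e = "\<lambda>t. \<Sum>k\<in>nodes N. e k t \<bullet> e k t" and ?u = "\<lambda>t. \<Sum>k\<in>nodes N. u k t \<bullet> u k t"
  have nonneg: "0 \<le> ?e t" "0 \<le> ?u t" for t by (auto intro!: sum_nonneg simp: scalar_prod_self)
  have su: "summable ?u" using u by (auto simp: l2_norm_def split: if_splits)
  have le: "sum ?e {..<n} \<le> c^2 * suminf ?u" for n
  proof -
    have "c^2 * sum ?u {..<n} \<le> c^2 * suminf ?u"
      using su nonneg by (intro mult_left_mono sum_le_suminf) auto
    then show ?thesis using assms(1)[of n] by linarith
  qed
  have se: "summable ?e" using nonneg(1) le by (rule summableI_nonneg_bounded)
  have "suminf ?e \<le> c^2 * suminf ?u" using se le by (rule suminf_le_const)
  then have "sqrt (suminf ?e) \<le> c * sqrt (suminf ?u)"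
    using c real_sqrt_le_mono by (fastforce simp: real_sqrt_mult)
  then show ?thesis
    using su se c by (simp add: l2_norm_def ennreal_mult'[symmetric] ennreal_leI)
qed

lemma balanced_gramians_bounds:
  assumes sys: "distributed_system N E S" and bal: "balanced_gramians N E S \<Sigma> \<Sigma>s"
  obtains \<rho> M where "balanced_bounds N E S \<Sigma> \<Sigma>s \<rho> M"
proof -
  from bal obtain \<beta> where \<beta>: "0 < \<beta>"
    and \<Sigma>: "\<forall>k\<in>nodes N. uniformly_bounded (\<Sigma> k) \<and> (\<forall>t. \<Sigma> k t \<in> carrier_mat (tdim S k t) (tdim S k t) \<and>
      diagonal_mat (\<Sigma> k t) \<and> \<beta> \<cdot>\<^sub>m 1\<^sub>m (tdim S k t) \<prec>\<^sub>L \<Sigma> k t \<and> decreasing_diag (\<Sigma> k t))"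
    and \<Sigma>s: "\<forall>e\<in>E. uniformly_bounded (\<Sigma>s e) \<and> (\<forall>t. \<Sigma>s e t \<in> carrier_mat (sdim S e t) (sdim S e t) \<and>
      diagonal_mat (\<Sigma>s e t) \<and> \<beta> \<cdot>\<^sub>m 1\<^sub>m (sdim S e t) \<prec>\<^sub>L \<Sigma>s e t \<and> decreasing_diag (\<Sigma>s e t))"
    and lyap: "\<And>k t. k \<in> nodes N \<Longrightarrow>
      Amat S k t * diag_block_mat (at_in E \<Sigma> \<Sigma>s k t) * (Amat S k t)\<^sup>T - diag_block_mat (at_out E \<Sigma> \<Sigma>s k (Suc t))
        + Bmat S k t * (Bmat S k t)\<^sup>T \<prec>\<^sub>L (- \<beta>) \<cdot>\<^sub>m 1\<^sub>m (dim_row (Amat S k t)) \<and>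
      (Amat S k t)\<^sup>T * diag_block_mat (at_out E \<Sigma> \<Sigma>s k (Suc t)) * Amat S k t - diag_block_mat (at_in E \<Sigma> \<Sigma>s k t)
        + (Cmat S k t)\<^sup>T * Cmat S k t \<prec>\<^sub>L (- \<beta>) \<cdot>\<^sub>m 1\<^sub>m (dim_col (Amat S k t))"
    unfolding balanced_gramians_def Let_def Suc_eq_plus1 by (elim exE conjE) blast
  have "\<exists>c. \<forall>t i. i < tdim S k t \<longrightarrow> \<Sigma> k t $$ (i,i) \<le> c" if "k \<in> nodes N" for k
    using that \<Sigma> uniformly_bounded_diag_entry[of "\<Sigma> k" "tdim S k"] by metis
  then obtain cn where cn: "\<And>k t i. k \<in> nodes N \<Longrightarrow> i < tdim S k t \<Longrightarrow> \<Sigma> k t $$ (i,i) \<le> cn k" by metis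
  have "\<exists>c. \<forall>t i. i < sdim S e t \<longrightarrow> \<Sigma>s e t $$ (i,i) \<le> c" if "e \<in> E" for e
    using that \<Sigma>s uniformly_bounded_diag_entry[of "\<Sigma>s e" "sdim S e"] by metis
  then obtain cs where cs: "\<And>e t i. e \<in> E \<Longrightarrow> i < sdim S e t \<Longrightarrow> \<Sigma>s e t $$ (i,i) \<le> cs e" by metis
  \<comment> \<open>Finiteness of the graph allows one constant for all blocks. The term
    \<open>2 * \<beta>\<close> keeps \<beta> below \<open>M\<close>, and the contraction factor
    positive, even if every state dimension is zero.\<close>
  define M where "M = 2 * \<beta> + (\<Sum>k\<in>nodes N. \<bar>cn k\<bar>) + (\<Sum>e\<in>E. \<bar>cs e\<bar>)"
  have sums: "0 \<le> (\<Sum>k\<in>nodes N. \<bar>cn k\<bar>)" "0 \<le> (\<Sum>e\<in>E. \<bar>cs e\<bar>)" by (auto intro: sum_nonneg)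
  then have M: "\<beta> < M" using \<beta> unfolding M_def by linarith
  have Mn: "\<Sigma> k t $$ (i,i) \<le> M" if "k \<in> nodes N" "i < tdim S k t" for k t i
  proof -
    have "\<bar>cn k\<bar> \<le> (\<Sum>k\<in>nodes N. \<bar>cn k\<bar>)" using that by (intro member_le_sum) auto
    then show ?thesis using cn[OF that] sums \<beta> unfolding M_def by linarith
  qed
  have Ms: "\<Sigma>s e t $$ (i,i) \<le> M" if "e \<in> E" "i < sdim S e t" for e t i
  proof -
    have "\<bar>cs e\<bar> \<le> (\<Sum>e\<in>E. \<bar>cs e\<bar>)" using that finite_E[OF sys] by (intro member_le_sum) auto
    then show ?thesis using cs[OF that] sums \<beta> unfolding M_def by linarith
  qed
  have pn: "0 < \<Sigma> k t $$ (i,i)" if "k \<in> nodes N" "i < tdim S k t" for k t i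
    using loewner_less_diag_entry[of \<beta> "tdim S k t" "\<Sigma> k t" i] \<Sigma> that \<beta> by force
  have ps: "0 < \<Sigma>s e t $$ (i,i)" if "e \<in> E" "i < sdim S e t" for e t i
    using loewner_less_diag_entry[of \<beta> "sdim S e t" "\<Sigma>s e t" i] \<Sigma>s that \<beta> by force
  have car: "item \<Sigma> \<Sigma>s t b \<in> carrier_mat (item (tdim S) (sdim S) t b) (item (tdim S) (sdim S) t b) \<and>
      diagonal_mat (item \<Sigma> \<Sigma>s t b)"
    if "k \<in> nodes N" "b \<in> set (in_items E k) \<union> set (out_items E k)" for k t b
    using that \<Sigma> \<Sigma>s by (auto elim!: in_items_cases[OF sys] out_items_cases[OF sys])
  have block: "diag_block_mat (map (item \<Sigma> \<Sigma>s t) bs)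
        \<in> carrier_mat (sum_list (map (item (tdim S) (sdim S) t) bs)) (sum_list (map (item (tdim S) (sdim S) t) bs))"
      "diagonal_mat (diag_block_mat (map (item \<Sigma> \<Sigma>s t) bs))"
      "\<And>p. p < sum_list (map (item (tdim S) (sdim S) t) bs) \<Longrightarrow>
        0 < diag_block_mat (map (item \<Sigma> \<Sigma>s t) bs) $$ (p,p) \<and> diag_block_mat (map (item \<Sigma> \<Sigma>s t) bs) $$ (p,p) \<le> M"
    if k: "k \<in> nodes N" and bs: "bs = in_items E k \<or> bs = out_items E k" for k t bs
  proof -
    have c: "item \<Sigma> \<Sigma>s t b \<in> carrier_mat (item (tdim S) (sdim S) t b) (item (tdim S) (sdim S) t b) \<and>
      diagonal_mat (item \<Sigma> \<Sigma>s t b)" if "b \<in> set bs" for b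
      using car[OF k, of b t] bs that by auto
    show "diag_block_mat (map (item \<Sigma> \<Sigma>s t) bs)
        \<in> carrier_mat (sum_list (map (item (tdim S) (sdim S) t) bs)) (sum_list (map (item (tdim S) (sdim S) t) bs))"
      using c by (intro diag_block_mat_carrier) blast
    show "diagonal_mat (diag_block_mat (map (item \<Sigma> \<Sigma>s t) bs))"
      using c by (rule diagonal_diag_block_mat)
    fix p assume p: "p < sum_list (map (item (tdim S) (sdim S) t) bs)"
    obtain b i where b: "b \<in> set bs" "i < item (tdim S) (sdim S) t b"
      and eq: "\<And>M :: _ \<Rightarrow> real mat. (\<forall>b\<in>set bs. M b \<in> carrier_mat (item (tdim S) (sdim S) t b) (item (tdim S) (sdim S) t b)) \<Longrightarrow>
        diag_block_mat (map M bs) $$ (p, p) = M b $$ (i, i)"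
      using locate_position[OF p] by blast
    have "b = Inl k \<or> (\<exists>e\<in>E. b = Inr e)"
      using b(1) bs by (auto elim!: in_items_cases[OF sys] out_items_cases[OF sys])
    then have "0 < item \<Sigma> \<Sigma>s t b $$ (i,i) \<and> item \<Sigma> \<Sigma>s t b $$ (i,i) \<le> M"
      using b(2) pn[OF k] ps Mn[OF k] Ms by auto
    then show "0 < diag_block_mat (map (item \<Sigma> \<Sigma>s t) bs) $$ (p,p) \<and> diag_block_mat (map (item \<Sigma> \<Sigma>s t) bs) $$ (p,p) \<le> M"
      using eq[of "item \<Sigma> \<Sigma>s t"] c by simp
  qed
  show thesis
  proof (rule that[of "1 - \<beta> / M" M], unfold_locales)
    show "distributed_system N E S" by (fact sys)
    show "0 \<le> 1 - \<beta> / M" "1 - \<beta> / M < 1" using \<beta> M by auto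
  next
    fix k t and v :: "real vec" assume k: "k \<in> nodes N" and v: "v \<in> carrier_vec (sum_list (in_dims E S k t))"
    note mats = realization_carrier[OF sys k, of t]
    have ly: "(Amat S k t)\<^sup>T * diag_block_mat (at_out E \<Sigma> \<Sigma>s k (Suc t)) * Amat S k t - diag_block_mat (at_in E \<Sigma> \<Sigma>s k t)
        + (Cmat S k t)\<^sup>T * Cmat S k t \<prec>\<^sub>L (- \<beta>) \<cdot>\<^sub>m 1\<^sub>m (sum_list (in_dims E S k t))"
      using lyap[OF k, of t] carrier_matD(2)[OF mats(1)] by simp
    show "(\<Sum>p<sum_list (out_dims E S k (Suc t)). diag_block_mat (at_out E \<Sigma> \<Sigma>s k (Suc t)) $$ (p,p) * ((Amat S k t *\<^sub>v v) $ p)^2)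
        + (Cmat S k t *\<^sub>v v) \<bullet> (Cmat S k t *\<^sub>v v)
      \<le> (\<Sum>p<sum_list (in_dims E S k t). diag_block_mat (at_in E \<Sigma> \<Sigma>s k t) $$ (p,p) * (v $ p)^2)"
      using block(1,2)[OF k] \<beta> v
      by (intro observability_inequality[OF mats(1) mats(3) _ _ _ _ ly]) (simp_all add: at_in_items at_out_items)
  next
    fix k t and v u :: "real vec" assume k: "k \<in> nodes N" and v: "v \<in> carrier_vec (sum_list (in_dims E S k t))"
      and u: "u \<in> carrier_vec (udim S k t)"
    note mats = realization_carrier[OF sys k, of t]
    have ly: "Amat S k t * diag_block_mat (at_in E \<Sigma> \<Sigma>s k t) * (Amat S k t)\<^sup>T - diag_block_mat (at_out E \<Sigma> \<Sigma>s k (Suc t))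
        + Bmat S k t * (Bmat S k t)\<^sup>T \<prec>\<^sub>L (- \<beta>) \<cdot>\<^sub>m 1\<^sub>m (sum_list (out_dims E S k (Suc t)))"
      using lyap[OF k, of t] carrier_matD(1)[OF mats(1)] by simp
    show "(\<Sum>p<sum_list (out_dims E S k (Suc t)). ((Amat S k t *\<^sub>v v + Bmat S k t *\<^sub>v u) $ p)^2
          / diag_block_mat (at_out E \<Sigma> \<Sigma>s k (Suc t)) $$ (p,p))
      \<le> (1 - \<beta> / M) * ((\<Sum>p<sum_list (in_dims E S k t). (v $ p)^2 / diag_block_mat (at_in E \<Sigma> \<Sigma>s k t) $$ (p,p)) + u \<bullet> u)"
      using block[OF k] \<beta> M u v
      by (intro controllability_inequality[OF mats(1,2) _ _ _ _ _ _ _ ly]) (simp_all add: at_in_items at_out_items)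
  qed (use \<Sigma> \<Sigma>s pn ps Mn Ms in blast)+
qed

lemma diag_block_lower_entry:
  fixes x :: real
  assumes "G \<in> carrier_mat r r" "H \<in> carrier_mat (d - r) (d - r)" "H = x \<cdot>\<^sub>m 1\<^sub>m (d - r)" "r \<le> i" "i < d"
  shows "diag_block_mat [G, H] $$ (i,i) = x"
  using assms by (auto simp: Let_def)

theorem theorem3:
  fixes N :: nat and E :: "(nat \<times> nat) set" and S :: dist_sys
    and \<Sigma> \<Gamma> \<Omega> :: "nat \<Rightarrow> nat \<Rightarrow> real mat"
    and \<Sigma>s \<Gamma>s \<Omega>s :: "nat \<times> nat \<Rightarrow> nat \<Rightarrow> real mat"
    and r :: "nat \<Rightarrow> nat \<Rightarrow> nat" and rs :: "nat \<times> nat \<Rightarrow> nat \<Rightarrow> nat"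
    and w :: "nat \<Rightarrow> nat \<Rightarrow> real" and ws :: "nat \<times> nat \<Rightarrow> nat \<Rightarrow> real"
    and F :: "nat \<Rightarrow> nat set" and Fs :: "nat \<times> nat \<Rightarrow> nat set"
  defines "F \<equiv> (\<lambda>k. trunc_times (tdim S k) (r k))"
    and "Fs \<equiv> (\<lambda>e. trunc_times (sdim S e) (rs e))"
  assumes "distributed_system N E S"
    and "balanced_gramians N E S \<Sigma> \<Sigma>s"
    and "\<And>k t. k \<in> nodes N \<Longrightarrow> r k t \<le> tdim S k t"
    and "\<And>e t. e \<in> E \<Longrightarrow> rs e t \<le> sdim S e t"
    and "\<And>k t. k \<in> nodes N \<Longrightarrow>
          \<Gamma> k t \<in> carrier_mat (r k t) (r k t) \<and>
          \<Omega> k t \<in> carrier_mat (tdim S k t - r k t) (tdim S k t - r k t) \<and>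
          \<Sigma> k t = diag_block_mat [\<Gamma> k t, \<Omega> k t]"
    and "\<And>e t. e \<in> E \<Longrightarrow>
          \<Gamma>s e t \<in> carrier_mat (rs e t) (rs e t) \<and>
          \<Omega>s e t \<in> carrier_mat (sdim S e t - rs e t) (sdim S e t - rs e t) \<and>
          \<Sigma>s e t = diag_block_mat [\<Gamma>s e t, \<Omega>s e t]"
    and "\<And>k t. k \<in> nodes N \<Longrightarrow> t \<in> F k \<Longrightarrow> \<Omega> k t = w k t \<cdot>\<^sub>m 1\<^sub>m (tdim S k t - r k t)"
    and "\<And>e t. e \<in> E \<Longrightarrow> t \<in> Fs e \<Longrightarrow> \<Omega>s e t = ws e t \<cdot>\<^sub>m 1\<^sub>m (sdim S e t - rs e t)"
    and "\<And>k. k \<in> nodes N \<Longrightarrow> mono_on (F k) (w k) \<or> antimono_on (F k) (w k)"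
    and "\<And>e. e \<in> E \<Longrightarrow> mono_on (Fs e) (ws e) \<or> antimono_on (Fs e) (ws e)"
    and "(\<exists>k \<in> nodes N. F k \<noteq> {}) \<or> (\<exists>e \<in> E. Fs e \<noteq> {})"
      \<comment> \<open>if nothing is truncated, both sides of the strict inequality are 0\<close>
  shows "induced_norm N (error_map (io_map N E S) (io_map N E (truncation E S r rs))) <
           2 * ((\<Sum>k \<in> nodes N. SUP t \<in> F k. ennreal (w k t)) +
                (\<Sum>e \<in> E. SUP t \<in> Fs e. ennreal (ws e t)))"
      \<comment> \<open>in the type ennreal, the supremum of the empty set is 0\<close>
proof -
  note r = assms(5) and rs = assms(6)
  obtain \<rho> M where "balanced_bounds N E S \<Sigma> \<Sigma>s \<rho> M"
    using balanced_gramians_bounds[OF assms(3,4)] .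
  then interpret balanced_bounds N E S \<Sigma> \<Sigma>s \<rho> M .
  have new: "t \<in> F k \<and> \<Sigma> k t $$ (i,i) = w k t" if "k \<in> nodes N" "r k t \<le> i" "i < tdim S k t" for k t i
  proof -
    have t: "t \<in> F k" using that by (auto simp: F_def trunc_times_def)
    then show ?thesis
      using assms(7)[OF that(1), of t] assms(9)[OF that(1) t] that
      by (metis diag_block_lower_entry)
  qed
  have new_s: "t \<in> Fs e \<and> \<Sigma>s e t $$ (i,i) = ws e t" if "e \<in> E" "rs e t \<le> i" "i < sdim S e t" for e t i
  proof -
    have t: "t \<in> Fs e" using that by (auto simp: Fs_def trunc_times_def)
    then show ?thesis
      using assms(8)[OF that(1), of t] assms(10)[OF that(1) t] that
      by (metis diag_block_lower_entry)
  qed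
  \<comment> \<open>At a truncation time the removed block is nonempty, so \<open>w k t\<close> is a
    diagonal entry of the gramian and inherits its bounds.\<close>
  have w: "0 < w k t \<and> w k t \<le> M" if "k \<in> nodes N" "t \<in> F k" for k t
  proof -
    have "r k t < tdim S k t" using that r[of k t] by (simp add: F_def trunc_times_def)
    then show ?thesis using new[of k t "r k t"] \<Sigma>(2,3)[of k "r k t" t] that by auto
  qed
  have ws: "0 < ws e t \<and> ws e t \<le> M" if "e \<in> E" "t \<in> Fs e" for e t
  proof -
    have "rs e t < sdim S e t" using that rs[of e t] by (simp add: Fs_def trunc_times_def)
    then show ?thesis using new_s[of e t "rs e t"] \<Sigma>s(2,3)[of e "rs e t" t] that by auto
  qed
  \<comment> \<open>On the graph the suprema are at most \<open>M\<close>, hence finite, so nothing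
    is lost in passing to reals; an empty set of times gives 0.\<close>
  define W where "W k = enn2real (SUP t\<in>F k. ennreal (w k t))" for k
  define Ws where "Ws e = enn2real (SUP t\<in>Fs e. ennreal (ws e t))" for e
  have W: "ennreal (W k) = (SUP t\<in>F k. ennreal (w k t))" if "k \<in> nodes N" for k
  proof -
    have "(SUP t\<in>F k. ennreal (w k t)) \<le> ennreal M" using w[OF that] by (intro SUP_least ennreal_leI) auto
    then show ?thesis by (simp add: W_def le_less_trans[OF _ ennreal_less_top])
  qed
  have Ws: "ennreal (Ws e) = (SUP t\<in>Fs e. ennreal (ws e t))" if "e \<in> E" for e
  proof -
    have "(SUP t\<in>Fs e. ennreal (ws e t)) \<le> ennreal M" using ws[OF that] by (intro SUP_least ennreal_leI) auto
    then show ?thesis by (simp add: Ws_def le_less_trans[OF _ ennreal_less_top])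
  qed
  have W0: "0 \<le> W k" "0 \<le> Ws e" for k e by (simp_all add: W_def Ws_def)
  have wW: "w k t \<le> W k" if "k \<in> nodes N" "t \<in> F k" for k t
  proof -
    have "ennreal (w k t) \<le> ennreal (W k)" unfolding W[OF that(1)] using that(2) by (rule SUP_upper)
    then show ?thesis using W0 by simp
  qed
  have wsW: "ws e t \<le> Ws e" if "e \<in> E" "t \<in> Fs e" for e t
  proof -
    have "ennreal (ws e t) \<le> ennreal (Ws e)" unfolding Ws[OF that(1)] using that(2) by (rule SUP_upper)
    then show ?thesis using W0 by simp
  qed
  define T where "T = (\<Sum>k\<in>nodes N. W k) + (\<Sum>e\<in>E. Ws e)"
  \<comment> \<open>Some block is truncated at some time, and \<open>w\<close> is positive there;
    this is what keeps \<open>sqrt \<rho> * T\<close> strictly below \<open>T\<close>.\<close>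
  have T: "0 < T"
    using assms(13)
  proof (elim disjE bexE)
    fix k assume k: "k \<in> nodes N" "F k \<noteq> {}"
    then obtain t where "t \<in> F k" by blast
    then have "0 < W k" using w[OF k(1)] wW[OF k(1)] by fastforce
    then have "0 < (\<Sum>k\<in>nodes N. W k)" using k(1) W0 by (intro sum_pos2) auto
    then show ?thesis unfolding T_def using W0(2) by (intro add_pos_nonneg sum_nonneg)
  next
    fix e assume e: "e \<in> E" "Fs e \<noteq> {}"
    then obtain t where "t \<in> Fs e" by blast
    then have "0 < Ws e" using ws[OF e(1)] wsW[OF e(1)] by fastforce
    then have "0 < (\<Sum>e\<in>E. Ws e)" using e(1) W0 finite_E[OF sys] by (intro sum_pos2) auto
    then show ?thesis unfolding T_def using W0(1) by (intro add_nonneg_pos sum_nonneg)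
  qed
  have "induced_norm N (error_map (io_map N E S) (io_map N E (truncation E S r rs))) \<le> ennreal (2 * sqrt \<rho> * T)"
    unfolding induced_norm_def
  proof (rule SUP_least, clarify)
    fix u e assume e: "(u, e) \<in> error_map (io_map N E S) (io_map N E (truncation E S r rs))" and u: "l2_norm N u < \<infinity>"
    then obtain y z where yz: "(u, y) \<in> io_map N E S" "(u, z) \<in> io_map N E (truncation E S r rs)"
      and e_eq: "e = (\<lambda>k t. y k t - z k t)" by (auto simp: error_map_def)
    have "(\<Sum>t<n. \<Sum>k\<in>nodes N. e k t \<bullet> e k t) \<le> (2 * sqrt \<rho> * T)^2 * (\<Sum>t<n. \<Sum>k\<in>nodes N. u k t \<bullet> u k t)" for n
      unfolding e_eq T_def
    proof (rule truncation_error_energy[where F = F and Fs = Fs and w = w and ws = ws])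
      show "0 \<le> W k" "0 \<le> Ws e" for k e by (fact W0)+
    qed (fact r rs new new_s assms(11,12) w[THEN conjunct1] ws[THEN conjunct1] wW wsW yz)+
    then have "l2_norm N e \<le> ennreal (2 * sqrt \<rho> * T) * l2_norm N u"
      using \<rho> T u by (intro l2_norm_le_scaled) auto
    then show "l2_norm N e / l2_norm N u \<le> ennreal (2 * sqrt \<rho> * T)"
      \<comment> \<open>If the input norm is 0, the error norm is 0 as well, and 0 / 0 = 0 in
        \<open>ennreal\<close>.\<close>
      by (cases "l2_norm N u = 0")
        (auto intro!: divide_le_posI_ennreal simp: mult.commute zero_less_iff_neq_zero)
  qed
  \<comment> \<open>Strictness enters after the supremum, through a factor that does not depend on
    the input.\<close>
  also have "\<dots> < ennreal (2 * T)"
    using \<rho> T by (simp add: ennreal_less_iff)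
  also have "ennreal (2 * T) = 2 * ((\<Sum>k\<in>nodes N. ennreal (W k)) + (\<Sum>e\<in>E. ennreal (Ws e)))"
    unfolding T_def using W0 by (simp add: ennreal_mult' ennreal_plus sum_ennreal sum_nonneg)
  also have "\<dots> = 2 * ((\<Sum>k \<in> nodes N. SUP t \<in> F k. ennreal (w k t)) + (\<Sum>e \<in> E. SUP t \<in> Fs e. ennreal (ws e t)))"
    using W Ws by simp
  finally show ?thesis .
qed

end
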